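(* Let $(\Phi,h)$ be a weighted gain graph and $O$ a linear ordering of its edge set $E$. The forest expansion $$F_{(\Phi,h),O}(\mathbf{u},y)=\sum_{F}y^{\epsilon(F)}\prod_{W\in\pi(F)}u_{h/F(W)},$$ summed over all spanning forests $F$ of $\Phi$, is independent of $O$; indeed $F_{(\Phi,h),O}(\mathbf{u},y)=Q_{(\Phi,h)}(\mathbf{u},y-1,0)$.
   Context: A graph $\Gamma=(V,E)$ is finite, $V=\{v_1,\dots,v_n\}$, multiple edges allowed; an edge is a link, loop, half edge (one endpoint) or loose edge (no endpoint). A gain graph $\Phi$ has a lattice-ordered gain group $\mathfrak{G}$ and gains $\varphi(e)$ on links and loops with $\varphi(e^{-1})=\varphi(e)^{-1}$; the gain of a walk is the product of its gains. A circle is a connected 2-regular subgraph without half edges; an edge set is balanced if it has no half edges and all its circles have gain $1$. In this context a loose edge is treated as a loop of gain $1$ (a balanced loop) and a half edge as a loop of gain $\ne1$ (an unbalanced loop). For $S\subseteq E$: $c(S)$, $\pi(S)$ are the number and the vertex-set partition of connected components of $(V,S)$ (isolated vertices count); $b(S)$ counts balanced components and $\pi_b(S)$ lists their vertex sets. For a balanced component with vertex set $W$ and $v\in W$, $\eta_S(v)=\bigvee_{w\in W}\varphi(S_{vw})$ where $S_{vw}$ is any path in $S$ from $v$ to $w$. A weighted gain graph has an abelian semigroup $\mathfrak{W}$ (additive) with right $\mathfrak{G}$-action by automorphisms and weights $h_i=h(v_i)\in\mathfrak{W}$; for $W\in\pi_b(S)$, $h/S(W)=\sum_{v_i\in W}h_i\eta_S(v_i)$.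 The total dichromatic polynomial, with indeterminates $u_k$ ($k\in\mathfrak{W}$), $v$, $z$, is $Q_{(\Phi,h)}(\mathbf{u},v,z)=\sum_{S\subseteq E}v^{|S|-n+b(S)}z^{c(S)-b(S)}\prod_{W\in\pi_b(S)}u_{h/S(W)}$ (with $z^0=1$ when $z=0$). A spanning forest is an edge set containing no circle (hence balanced, with no loops, half or loose edges). For a spanning forest $F$, $\mathrm{clos}(F)=F\cup\{e\notin F: F\cup\{e\}\text{ contains a balanced circle}\}$; for $e\in\mathrm{clos}(F)\setminus F$ the fundamental circle $C_F(e)$ is the unique circle in $F\cup\{e\}$; $e$ is externally active if $e\in\mathrm{clos}(F)\setminus F$ and $e$ is the largest element of $C_F(e)$ in $O$; $\epsilon(F)$ is the number of externally active edges. *)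

theory Defs
  imports Main
begin

(* Lattice-ordered groups, written additively but not assumed commutative:
   the identity gain 1 is 0, products are sums, and inverses are negatives. *)
class lattice_ordered_group = group_add + lattice +
  assumes translate_left_mono: "a \<le> b \<Longrightarrow> c + a \<le> c + b"
    and translate_right_mono: "a \<le> b \<Longrightarrow> a + c \<le> b + c"

(* Sum over a finite nonempty set in a semigroup that need not have a zero.
   The element removed first is irrelevant; see sum_nonempty_insert. *)
definition sum_nonempty :: "('a \<Rightarrow> 'w::ab_semigroup_add) \<Rightarrow> 'a set \<Rightarrow> 'w" where
  "sum_nonempty f A =
     (let x = (SOME x. x \<in> A) in Finite_Set.fold (\<lambda>y s. f y + s) (f x) (A - {x}))"

lemma sum_nonempty_singleton: "sum_nonempty f {x} = f x"
  by (simp add: sum_nonempty_def)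

lemma sum_nonempty_remove:
  fixes f :: "'a \<Rightarrow> 'w::ab_semigroup_add"
  assumes "finite A" "x \<in> A"
  shows "sum_nonempty f A = Finite_Set.fold (\<lambda>y s. f y + s) (f x) (A - {x})"
proof -
  interpret comp_fun_commute "\<lambda>y s. f y + s"
    by standard (simp add: fun_eq_iff ac_simps)
  define x0 where "x0 = (SOME x. x \<in> A)"
  have x0: "x0 \<in> A"
    unfolding x0_def using assms(2) by (rule someI)
  have "Finite_Set.fold (\<lambda>y s. f y + s) (f x0) (A - {x0})
      = Finite_Set.fold (\<lambda>y s. f y + s) (f x) (A - {x})"
  proof (cases "x = x0")
    case False
    define B where "B = A - {x0} - {x}"
    have "finite B" "x \<notin> B" "x0 \<notin> B" and A: "A - {x0} = insert x B" "A - {x} = insert x0 B"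
      using assms x0 False by (auto simp: B_def)
    have "Finite_Set.fold (\<lambda>y s. f y + s) (f x0) (insert x B)
        = Finite_Set.fold (\<lambda>y s. f y + s) (f x + f x0) B"
      using \<open>finite B\<close> \<open>x \<notin> B\<close> by (rule fold_insert2)
    moreover have "Finite_Set.fold (\<lambda>y s. f y + s) (f x) (insert x0 B)
        = Finite_Set.fold (\<lambda>y s. f y + s) (f x0 + f x) B"
      using \<open>finite B\<close> \<open>x0 \<notin> B\<close> by (rule fold_insert2)
    ultimately show ?thesis
      by (simp add: A add.commute)
  qed simp
  then show ?thesis
    by (simp add: sum_nonempty_def x0_def Let_def)
qed

lemma sum_nonempty_insert:
  fixes f :: "'a \<Rightarrow> 'w::ab_semigroup_add"
  assumes "finite A" "A \<noteq> {}" "x \<notin> A"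
  shows "sum_nonempty f (insert x A) = f x + sum_nonempty f A"
proof -
  interpret comp_fun_commute "\<lambda>y s. f y + s"
    by standard (simp add: fun_eq_iff ac_simps)
  obtain a where a: "a \<in> A" using assms(2) by blast
  have "insert x A - {a} = insert x (A - {a})" using a assms(3) by blast
  then show ?thesis
    using assms a sum_nonempty_remove[of "insert x A" a f] sum_nonempty_remove[of A a f]
    by simp
qed

(* Ordinary a b g is a link (a \<noteq> b) or a loop (a = b) whose gain is g when traversed
   from a to b and -g in the reverse direction. *)
datatype ('v, 'g) edge = Ordinary 'v 'v 'g | Half 'v | Loose

record ('v, 'e, 'g) gain_graph =
  verts :: "'v set"
  edges :: "'e set"
  edge_of :: "'e \<Rightarrow> ('v, 'g) edge"

fun endpoints :: "('v, 'g) edge \<Rightarrow> 'v set" where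
  "endpoints (Ordinary a b g) = {a, b}"
| "endpoints (Half a) = {a}"
| "endpoints Loose = {}"

fun is_ordinary :: "('v, 'g) edge \<Rightarrow> bool" where
  "is_ordinary (Ordinary a b g) = True"
| "is_ordinary (Half a) = False"
| "is_ordinary Loose = False"

fun is_half :: "('v, 'g) edge \<Rightarrow> bool" where
  "is_half (Ordinary a b g) = False"
| "is_half (Half a) = True"
| "is_half Loose = False"

definition wf_gain_graph :: "('v, 'e, 'g) gain_graph \<Rightarrow> bool" where
  "wf_gain_graph \<Phi> \<longleftrightarrow> finite (verts \<Phi>) \<and> finite (edges \<Phi>) \<and>
     (\<forall>e\<in>edges \<Phi>. endpoints (edge_of \<Phi> e) \<subseteq> verts \<Phi>)"

(* An oriented ordinary edge: (e, True) is e in its reference direction, (e, False) its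
   inverse. The functions below are only meaningful on ordinary edges. *)
type_synonym 'e dart = "'e \<times> bool"

definition dart_tail :: "('v, 'e, 'g) gain_graph \<Rightarrow> 'e dart \<Rightarrow> 'v" where
  "dart_tail \<Phi> d = (case edge_of \<Phi> (fst d) of Ordinary a b g \<Rightarrow> if snd d then a else b)"

definition dart_head :: "('v, 'e, 'g) gain_graph \<Rightarrow> 'e dart \<Rightarrow> 'v" where
  "dart_head \<Phi> d = (case edge_of \<Phi> (fst d) of Ordinary a b g \<Rightarrow> if snd d then b else a)"

definition dart_gain :: "('v, 'e, 'g::group_add) gain_graph \<Rightarrow> 'e dart \<Rightarrow> 'g" where
  "dart_gain \<Phi> d = (case edge_of \<Phi> (fst d) of Ordinary a b g \<Rightarrow> if snd d then g else - g)"

fun walk :: "('v, 'e, 'g) gain_graph \<Rightarrow> 'e set \<Rightarrow> 'v \<Rightarrow> 'e dart list \<Rightarrow> 'v \<Rightarrow> bool" where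
  "walk \<Phi> S x [] y \<longleftrightarrow> x \<in> verts \<Phi> \<and> x = y"
| "walk \<Phi> S x (d # ds) y \<longleftrightarrow>
     fst d \<in> S \<and> is_ordinary (edge_of \<Phi> (fst d)) \<and> dart_tail \<Phi> d = x \<and>
     walk \<Phi> S (dart_head \<Phi> d) ds y"

definition path :: "('v, 'e, 'g) gain_graph \<Rightarrow> 'e set \<Rightarrow> 'v \<Rightarrow> 'e dart list \<Rightarrow> 'v \<Rightarrow> bool" where
  "path \<Phi> S x ds y \<longleftrightarrow> walk \<Phi> S x ds y \<and> distinct (x # map (dart_head \<Phi>) ds)"

definition walk_gain :: "('v, 'e, 'g::group_add) gain_graph \<Rightarrow> 'e dart list \<Rightarrow> 'g" where
  "walk_gain \<Phi> ds = sum_list (map (dart_gain \<Phi>) ds)"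

fun edge_degree :: "('v, 'g) edge \<Rightarrow> 'v \<Rightarrow> nat" where
  "edge_degree (Ordinary a b g) x = of_bool (a = x) + of_bool (b = x)"
| "edge_degree (Half a) x = of_bool (a = x)"
| "edge_degree Loose x = 0"

definition degree :: "('v, 'e, 'g) gain_graph \<Rightarrow> 'e set \<Rightarrow> 'v \<Rightarrow> nat" where
  "degree \<Phi> S x = (\<Sum>e\<in>S. edge_degree (edge_of \<Phi> e) x)"

definition touched :: "('v, 'e, 'g) gain_graph \<Rightarrow> 'e set \<Rightarrow> 'v set" where
  "touched \<Phi> S = (\<Union>e\<in>S. endpoints (edge_of \<Phi> e))"

(* Connected 2-regular subgraphs made of links and loops, identified with their edge sets. *)
definition ordinary_circle :: "('v, 'e, 'g) gain_graph \<Rightarrow> 'e set \<Rightarrow> bool" where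
  "ordinary_circle \<Phi> C \<longleftrightarrow>
     C \<noteq> {} \<and> C \<subseteq> edges \<Phi> \<and> (\<forall>e\<in>C. is_ordinary (edge_of \<Phi> e)) \<and>
     (\<forall>x\<in>touched \<Phi> C. degree \<Phi> C x = 2) \<and>
     (\<forall>x\<in>touched \<Phi> C. \<forall>y\<in>touched \<Phi> C. \<exists>ds. walk \<Phi> C x ds y)"

(* Half edges count as unbalanced loops and loose edges as balanced loops, so each of them
   forms a circle by itself. *)
definition circle :: "('v, 'e, 'g) gain_graph \<Rightarrow> 'e set \<Rightarrow> bool" where
  "circle \<Phi> C \<longleftrightarrow> ordinary_circle \<Phi> C \<or>
     (\<exists>e\<in>edges \<Phi>. C = {e} \<and> \<not> is_ordinary (edge_of \<Phi> e))"

(* The closed walk once around an ordinary circle is unique up to starting point and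
   direction, which do not affect whether its gain is the identity. *)
definition balanced_circle :: "('v, 'e, 'g::group_add) gain_graph \<Rightarrow> 'e set \<Rightarrow> bool" where
  "balanced_circle \<Phi> C \<longleftrightarrow>
     (ordinary_circle \<Phi> C \<and>
       (\<exists>x ds. walk \<Phi> C x ds x \<and> distinct (map fst ds) \<and> fst ` set ds = C \<and>
          walk_gain \<Phi> ds = 0)) \<or>
     (\<exists>e\<in>edges \<Phi>. C = {e} \<and> edge_of \<Phi> e = Loose)"

definition balanced :: "('v, 'e, 'g::group_add) gain_graph \<Rightarrow> 'e set \<Rightarrow> bool" where
  "balanced \<Phi> S \<longleftrightarrow> (\<forall>e\<in>S. \<not> is_half (edge_of \<Phi> e)) \<and>
     (\<forall>C\<subseteq>S. circle \<Phi> C \<longrightarrow> balanced_circle \<Phi> C)"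

definition component :: "('v, 'e, 'g) gain_graph \<Rightarrow> 'e set \<Rightarrow> 'v \<Rightarrow> 'v set" where
  "component \<Phi> S x = {y. \<exists>ds. walk \<Phi> S x ds y}"

definition components :: "('v, 'e, 'g) gain_graph \<Rightarrow> 'e set \<Rightarrow> 'v set set" where
  "components \<Phi> S = component \<Phi> S ` verts \<Phi>"

definition component_edges :: "('v, 'e, 'g) gain_graph \<Rightarrow> 'e set \<Rightarrow> 'v set \<Rightarrow> 'e set" where
  "component_edges \<Phi> S W = {e \<in> S. endpoints (edge_of \<Phi> e) \<inter> W \<noteq> {}}"

definition balanced_components ::
    "('v, 'e, 'g::group_add) gain_graph \<Rightarrow> 'e set \<Rightarrow> 'v set set" where
  "balanced_components \<Phi> S = {W \<in> components \<Phi> S. balanced \<Phi> (component_edges \<Phi> S W)}"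

definition path_gain :: "('v, 'e, 'g::group_add) gain_graph \<Rightarrow> 'e set \<Rightarrow> 'v \<Rightarrow> 'v \<Rightarrow> 'g" where
  "path_gain \<Phi> S x y = walk_gain \<Phi> (SOME ds. path \<Phi> S x ds y)"

definition eta :: "('v, 'e, 'g::lattice_ordered_group) gain_graph \<Rightarrow> 'e set \<Rightarrow> 'v \<Rightarrow> 'g" where
  "eta \<Phi> S x = Sup_fin (path_gain \<Phi> S x ` component \<Phi> S x)"

(* A right action by semigroup endomorphisms; each is an automorphism, with inverse the
   action of the inverse group element. *)
definition right_action :: "('w::ab_semigroup_add \<Rightarrow> 'g::group_add \<Rightarrow> 'w) \<Rightarrow> bool" where
  "right_action act \<longleftrightarrow> (\<forall>k. act k 0 = k) \<and> (\<forall>k a b. act k (a + b) = act (act k a) b) \<and>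
     (\<forall>k l a. act (k + l) a = act k a + act l a)"

(* The contracted weight h/S(W). *)
definition contracted_weight ::
    "('v, 'e, 'g::lattice_ordered_group) gain_graph \<Rightarrow> ('w::ab_semigroup_add \<Rightarrow> 'g \<Rightarrow> 'w) \<Rightarrow>
      ('v \<Rightarrow> 'w) \<Rightarrow> 'e set \<Rightarrow> 'v set \<Rightarrow> 'w" where
  "contracted_weight \<Phi> act h S W = sum_nonempty (\<lambda>x. act (h x) (eta \<Phi> S x)) W"

(* Both polynomials are given by their values at elements of an arbitrary commutative ring;
   a polynomial ring with the indeterminates as arguments gives the formal polynomials.
   The exponents are differences of naturals that never truncate: a balanced component with
   m vertices has at least m - 1 edges, an unbalanced one at least m. *)
definition total_dichromatic ::
    "('v, 'e, 'g::lattice_ordered_group) gain_graph \<Rightarrow> ('w::ab_semigroup_add \<Rightarrow> 'g \<Rightarrow> 'w) \<Rightarrow>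
      ('v \<Rightarrow> 'w) \<Rightarrow> ('w \<Rightarrow> 'r::comm_ring_1) \<Rightarrow> 'r \<Rightarrow> 'r \<Rightarrow> 'r" where
  "total_dichromatic \<Phi> act h u v z =
     (\<Sum>S\<in>Pow (edges \<Phi>).
        v ^ (card S + card (balanced_components \<Phi> S) - card (verts \<Phi>)) *
        z ^ (card (components \<Phi> S) - card (balanced_components \<Phi> S)) *
        (\<Prod>W\<in>balanced_components \<Phi> S. u (contracted_weight \<Phi> act h S W)))"

definition spanning_forests :: "('v, 'e, 'g) gain_graph \<Rightarrow> 'e set set" where
  "spanning_forests \<Phi> = {F. F \<subseteq> edges \<Phi> \<and> \<not> (\<exists>C\<subseteq>F. circle \<Phi> C)}"

definition clos :: "('v, 'e, 'g::group_add) gain_graph \<Rightarrow> 'e set \<Rightarrow> 'e set" where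
  "clos \<Phi> F = F \<union> {e \<in> edges \<Phi> - F. \<exists>C\<subseteq>insert e F. balanced_circle \<Phi> C}"

definition fundamental_circle :: "('v, 'e, 'g) gain_graph \<Rightarrow> 'e set \<Rightarrow> 'e \<Rightarrow> 'e set" where
  "fundamental_circle \<Phi> F e = (THE C. C \<subseteq> insert e F \<and> circle \<Phi> C)"

definition externally_active ::
    "('v, 'e, 'g::group_add) gain_graph \<Rightarrow> 'e rel \<Rightarrow> 'e set \<Rightarrow> 'e set" where
  "externally_active \<Phi> R F =
     {e \<in> clos \<Phi> F - F. e \<in> fundamental_circle \<Phi> F e \<and>
        (\<forall>f\<in>fundamental_circle \<Phi> F e. (f, e) \<in> R)}"

definition forest_expansion ::
    "('v, 'e, 'g::lattice_ordered_group) gain_graph \<Rightarrow> ('w::ab_semigroup_add \<Rightarrow> 'g \<Rightarrow> 'w) \<Rightarrow>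
      ('v \<Rightarrow> 'w) \<Rightarrow> 'e rel \<Rightarrow> ('w \<Rightarrow> 'r::comm_ring_1) \<Rightarrow> 'r \<Rightarrow> 'r" where
  "forest_expansion \<Phi> act h R u y =
     (\<Sum>F\<in>spanning_forests \<Phi>.
        y ^ card (externally_active \<Phi> R F) *
        (\<Prod>W\<in>components \<Phi> F. u (contracted_weight \<Phi> act h F W)))"

end

theory Submission imports Defs begin

text \<open>
  At \<open>z = 0\<close> only balanced edge sets contribute to the total dichromatic polynomial. A balanced
  \<open>S\<close> decomposes uniquely as \<open>S = F \<union> A\<close>, where \<open>F\<close> is the greedy spanning forest of \<open>S\<close>
  (the edges whose ends are not joined by smaller edges of \<open>S\<close>) and \<open>A\<close> is any set of
  externally active edges of \<open>F\<close>. Both \<open>F\<close> and \<open>S\<close> have the same components, and a vertex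
  potential inducing the gains of \<open>F\<close> also induces those of \<open>S\<close>, so the contracted weights
  agree. The exponent of \<open>y - 1\<close> is \<open>|A|\<close>, and summing \<open>(y - 1)^|A|\<close> over the subsets of the
  externally active edges gives \<open>y^\<epsilon>(F)\<close>.
\<close>

text \<open>Circles are specified by degrees and connectedness, while gains and components are
  specified by walks. A parity count passes between the two: in a set of ordinary edges with all
  degrees even, no edge is a bridge. The same count makes fundamental circles unique, since two
  circles through one edge have a symmetric difference with even degrees. Balance is a condition on
  all circles at once, but one vertex potential \<open>p\<close> certifies it, and the gain of every
  path from \<open>x\<close> to \<open>y\<close> is then \<open>- p x + p y\<close>, whichever path
  is chosen. This is what makes the weights comparable although \<open>path_gain\<close> picks an
  arbitrary path. The greedy choice matches external activity because an ordinary edge that it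
  rejects is the largest edge of a circle whose other edges are chosen; if \<open>S\<close> is
  balanced, so is that circle. A loose edge is its own fundamental circle and hence always active.
  So the sets \<open>S\<close> with greedy forest \<open>F\<close> fill the whole Boolean interval
  from \<open>F\<close> to \<open>F\<close> plus its active edges.\<close>

section \<open>Darts, walks and potentials\<close>

lemma dart_cases:
  assumes "is_ordinary (edge_of \<Phi> (fst d))"
  obtains a b g where "edge_of \<Phi> (fst d) = Ordinary a b g" "dart_tail \<Phi> d = a"
      "dart_head \<Phi> d = b" "dart_gain \<Phi> d = g"
    | a b g where "edge_of \<Phi> (fst d) = Ordinary a b g" "dart_tail \<Phi> d = b"
      "dart_head \<Phi> d = a" "dart_gain \<Phi> d = - g"
  using assms
  by (cases "edge_of \<Phi> (fst d)"; cases "snd d")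
     (auto simp: dart_tail_def dart_head_def dart_gain_def)

lemma is_ordinaryD: "is_ordinary x \<Longrightarrow> \<exists>a b g. x = Ordinary a b g"
  by (cases x) auto

definition rev_dart :: "'e dart \<Rightarrow> 'e dart" where
  "rev_dart d = (fst d, \<not> snd d)"

lemma fst_rev_dart [simp]: "fst (rev_dart d) = fst d"
  by (simp add: rev_dart_def)

lemma rev_dart_ends:
  assumes "is_ordinary (edge_of \<Phi> (fst d))"
  shows "dart_tail \<Phi> (rev_dart d) = dart_head \<Phi> d" "dart_head \<Phi> (rev_dart d) = dart_tail \<Phi> d"
  using assms
  by (cases "edge_of \<Phi> (fst d)"; simp add: rev_dart_def dart_tail_def dart_head_def)+

lemma edge_degree_dart:
  assumes "is_ordinary (edge_of \<Phi> (fst d))"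
  shows "edge_degree (edge_of \<Phi> (fst d)) v = of_bool (v = dart_tail \<Phi> d) + of_bool (v = dart_head \<Phi> d)"
  using assms by (cases "edge_of \<Phi> (fst d)") (auto simp: dart_tail_def dart_head_def)

lemma endpoints_dart:
  assumes "is_ordinary (edge_of \<Phi> (fst d))"
  shows "endpoints (edge_of \<Phi> (fst d)) = {dart_tail \<Phi> d, dart_head \<Phi> d}"
  using assms by (cases "edge_of \<Phi> (fst d)") (auto simp: dart_tail_def dart_head_def)

lemma edge_degree_eq_0_iff: "edge_degree x v = 0 \<longleftrightarrow> v \<notin> endpoints x"
  by (cases x) auto

lemma walk_gain_simps [simp]:
  "walk_gain \<Phi> [] = 0"
  "walk_gain \<Phi> (d # ds) = dart_gain \<Phi> d + walk_gain \<Phi> ds"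
  "walk_gain \<Phi> (p @ q) = walk_gain \<Phi> p + walk_gain \<Phi> q"
  by (simp_all add: walk_gain_def)

lemma walk_edges: "walk \<Phi> S x ds y \<Longrightarrow> fst ` set ds \<subseteq> S"
  by (induction ds arbitrary: x) auto

lemma walk_ordinary: "walk \<Phi> S x ds y \<Longrightarrow> e \<in> fst ` set ds \<Longrightarrow> is_ordinary (edge_of \<Phi> e)"
  by (induction ds arbitrary: x) auto

lemma walk_restrict: "walk \<Phi> S x ds y \<Longrightarrow> fst ` set ds \<subseteq> T \<Longrightarrow> walk \<Phi> T x ds y"
  by (induction ds arbitrary: x) auto

lemma walk_mono: "walk \<Phi> S x ds y \<Longrightarrow> S \<subseteq> T \<Longrightarrow> walk \<Phi> T x ds y"
  by (rule walk_restrict) (auto dest: walk_edges)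

text \<open>A walk cannot leave a set that no ordinary edge of \<open>S\<close> crosses. The
  hypothesis is an equivalence because an edge may be traversed in either direction.\<close>

lemma component_subset_closed:
  assumes "\<And>e a b g. e \<in> S \<Longrightarrow> edge_of \<Phi> e = Ordinary a b g \<Longrightarrow> a \<in> K \<longleftrightarrow> b \<in> K"
    and "x \<in> K"
  shows "component \<Phi> S x \<subseteq> K"
proof -
  have "y \<in> K" if "walk \<Phi> S x ds y" "x \<in> K" for ds x y
    using that
  proof (induction ds arbitrary: x)
    case (Cons d ds)
    then have "is_ordinary (edge_of \<Phi> (fst d))" "fst d \<in> S" by auto
    then have "dart_tail \<Phi> d \<in> K \<longleftrightarrow> dart_head \<Phi> d \<in> K"
      using assms(1)[of "fst d"]
      by (cases "edge_of \<Phi> (fst d)") (auto simp: dart_tail_def dart_head_def)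
    then show ?case using Cons by auto
  qed auto
  then show ?thesis using assms(2) by (auto simp: component_def)
qed

text \<open>A switching function that trivializes the gains on \<open>S\<close>. Gains act on the
  right, so left translation of \<open>p\<close> on a whole component preserves the condition. Half
  and loose edges are unconstrained.\<close>

definition potential :: "('v, 'e, 'g::group_add) gain_graph \<Rightarrow> 'e set \<Rightarrow> ('v \<Rightarrow> 'g) \<Rightarrow> bool" where
  "potential \<Phi> S p \<longleftrightarrow>
     (\<forall>e\<in>S. \<forall>a b g. edge_of \<Phi> e = Ordinary a b g \<longrightarrow> p b = p a + g)"

lemma potential_walk:
  assumes "potential \<Phi> S p" "walk \<Phi> S x ds y"
  shows "p y = p x + walk_gain \<Phi> ds"
  using assms(2)
proof (induction ds arbitrary: x)
  case (Cons d ds)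
  then have "is_ordinary (edge_of \<Phi> (fst d))" "fst d \<in> S" by auto
  then have "p (dart_head \<Phi> d) = p (dart_tail \<Phi> d) + dart_gain \<Phi> d"
    using assms(1) by (cases rule: dart_cases) (auto simp: potential_def algebra_simps)
  then show ?case using Cons by (auto simp: add.assoc)
qed auto

lemma spanning_forest_subset:
  "F \<in> spanning_forests \<Phi> \<Longrightarrow> F' \<subseteq> F \<Longrightarrow> F' \<in> spanning_forests \<Phi>"
  unfolding spanning_forests_def by blast

lemma spanning_forest_edges: "F \<in> spanning_forests \<Phi> \<Longrightarrow> F \<subseteq> edges \<Phi>"
  unfolding spanning_forests_def by blast

lemma spanning_forest_no_circle: "F \<in> spanning_forests \<Phi> \<Longrightarrow> C \<subseteq> F \<Longrightarrow> \<not> circle \<Phi> C"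
  unfolding spanning_forests_def by blast

lemma spanning_forest_ordinary:
  assumes "F \<in> spanning_forests \<Phi>" "e \<in> F"
  shows "is_ordinary (edge_of \<Phi> e)"
proof (rule ccontr)
  assume "\<not> is_ordinary (edge_of \<Phi> e)"
  then have "circle \<Phi> {e}"
    using assms spanning_forest_edges by (auto simp: circle_def)
  then show False using spanning_forest_no_circle[OF assms(1), of "{e}"] assms(2) by simp
qed

lemma ordinary_circle_ordinary: "ordinary_circle \<Phi> C \<Longrightarrow> e \<in> C \<Longrightarrow> is_ordinary (edge_of \<Phi> e)"
  by (auto simp: ordinary_circle_def)

lemma balanced_circle_imp_circle: "balanced_circle \<Phi> C \<Longrightarrow> circle \<Phi> C"
  by (auto simp: balanced_circle_def circle_def)

lemma circle_singleton:
  "circle \<Phi> C \<Longrightarrow> \<not> ordinary_circle \<Phi> C \<Longrightarrow>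
    \<exists>e\<in>edges \<Phi>. C = {e} \<and> \<not> is_ordinary (edge_of \<Phi> e)"
  by (auto simp: circle_def)

text \<open>For \<open>v = y - 1\<close> the right-hand side becomes a power of \<open>y\<close>;
  this is how the activity exponent arises.\<close>

lemma sum_power_card_Pow:
  fixes v :: "'a::comm_ring_1"
  assumes "finite E"
  shows "(\<Sum>A\<in>Pow E. v ^ card A) = (1 + v) ^ card E"
  using assms
proof (induction E rule: finite_induct)
  case (insert x E)
  have "inj_on (insert x) (Pow E)" using insert by (auto simp: inj_on_def)
  moreover have "card (insert x A) = Suc (card A)" if "A \<in> Pow E" for A
    using that insert finite_subset[of A E] by (auto simp: card_insert_if)
  ultimately have "(\<Sum>A\<in>insert x ` Pow E. v ^ card A) = v * (\<Sum>A\<in>Pow E. v ^ card A)"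
    by (simp add: sum.reindex sum_distrib_left)
  moreover have "Pow E \<inter> insert x ` Pow E = {}" using insert by auto
  ultimately have "(\<Sum>A\<in>Pow (insert x E). v ^ card A)
      = (\<Sum>A\<in>Pow E. v ^ card A) + v * (\<Sum>A\<in>Pow E. v ^ card A)"
    using insert by (simp add: Pow_insert sum.union_disjoint)
  then show ?case using insert by (simp add: algebra_simps)
qed simp

section \<open>Walks and components in a finite gain graph\<close>

locale finite_gain_graph =
  fixes \<Phi> :: "('v, 'e, 'g::group_add) gain_graph"
  assumes wf: "wf_gain_graph \<Phi>"
begin

lemma finite_verts: "finite (verts \<Phi>)"
  and finite_edges: "finite (edges \<Phi>)"
  and endpoints_verts: "e \<in> edges \<Phi> \<Longrightarrow> endpoints (edge_of \<Phi> e) \<subseteq> verts \<Phi>"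
  using wf by (auto simp: wf_gain_graph_def)

lemma finite_edge_set: "S \<subseteq> edges \<Phi> \<Longrightarrow> finite S"
  using finite_edges finite_subset by blast

lemma walk_start_verts:
  assumes "S \<subseteq> edges \<Phi>" "walk \<Phi> S x ds y"
  shows "x \<in> verts \<Phi>"
proof (cases ds)
  case (Cons d ds')
  then have "is_ordinary (edge_of \<Phi> (fst d))" "fst d \<in> edges \<Phi>" "x = dart_tail \<Phi> d"
    using assms by auto
  then show ?thesis using endpoints_verts[of "fst d"] endpoints_dart[of \<Phi> d] by auto
qed (use assms in auto)

text \<open>The empty walk demands a vertex of the graph; \<open>S \<subseteq> edges \<Phi>\<close>
  guarantees this for the point where the walk is cut.\<close>

lemma walk_append:
  assumes "S \<subseteq> edges \<Phi>"
  shows "walk \<Phi> S x (p @ q) y \<longleftrightarrow> (\<exists>z. walk \<Phi> S x p z \<and> walk \<Phi> S z q y)"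
  by (induction p arbitrary: x) (auto dest: walk_start_verts[OF assms])

lemma walk_end_verts: "walk \<Phi> S x ds y \<Longrightarrow> y \<in> verts \<Phi>"
  by (induction ds arbitrary: x) auto

lemma walk_rev:
  assumes "S \<subseteq> edges \<Phi>" "walk \<Phi> S x ds y"
  shows "walk \<Phi> S y (rev (map rev_dart ds)) x"
  using assms(2)
proof (induction ds arbitrary: x)
  case (Cons d ds)
  then have "x \<in> verts \<Phi>" using walk_start_verts assms(1) by blast
  then show ?case using Cons by (auto simp: walk_append[OF assms(1)] rev_dart_ends)
qed auto

lemma component_mono: "S \<subseteq> T \<Longrightarrow> component \<Phi> S x \<subseteq> component \<Phi> T x"
  using walk_mono[of \<Phi> S x _ _ T] by (auto simp: component_def)

lemma component_self: "x \<in> verts \<Phi> \<Longrightarrow> x \<in> component \<Phi> S x"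
  unfolding component_def by (rule CollectI, rule exI[of _ "[]"]) simp

lemma component_verts: "component \<Phi> S x \<subseteq> verts \<Phi>"
  by (auto simp: component_def walk_end_verts)

lemma finite_component: "finite (component \<Phi> S x)"
  using component_verts finite_verts finite_subset by blast

lemma component_sym:
  "S \<subseteq> edges \<Phi> \<Longrightarrow> y \<in> component \<Phi> S x \<Longrightarrow> x \<in> component \<Phi> S y"
  unfolding component_def using walk_rev by blast

lemma component_trans:
  "S \<subseteq> edges \<Phi> \<Longrightarrow> y \<in> component \<Phi> S x \<Longrightarrow> z \<in> component \<Phi> S y \<Longrightarrow> z \<in> component \<Phi> S x"
  by (auto simp: component_def) (metis walk_append)

lemma component_eq:
  "S \<subseteq> edges \<Phi> \<Longrightarrow> y \<in> component \<Phi> S x \<Longrightarrow> component \<Phi> S y = component \<Phi> S x"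
  using component_sym[of S] component_trans[of S] by blast

lemma component_edge:
  assumes "S \<subseteq> edges \<Phi>" "e \<in> S" "edge_of \<Phi> e = Ordinary a b g"
  shows "b \<in> component \<Phi> S a"
proof -
  have "b \<in> verts \<Phi>" using endpoints_verts[of e] assms by auto
  then have "walk \<Phi> S a [(e, True)] b"
    using assms by (simp add: dart_head_def dart_tail_def)
  then show ?thesis unfolding component_def by blast
qed

text \<open>Each edge of \<open>S\<close> can be replaced by a walk in \<open>T\<close>, so
  comparing single edges suffices.\<close>

lemma component_subset_component:
  assumes "T \<subseteq> edges \<Phi>" "x \<in> verts \<Phi>"
    and "\<And>e a b g. e \<in> S \<Longrightarrow> edge_of \<Phi> e = Ordinary a b g \<Longrightarrow> b \<in> component \<Phi> T a"
  shows "component \<Phi> S x \<subseteq> component \<Phi> T x"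
proof (rule component_subset_closed)
  show "a \<in> component \<Phi> T x \<longleftrightarrow> b \<in> component \<Phi> T x"
    if "e \<in> S" "edge_of \<Phi> e = Ordinary a b g" for e a b g
    using assms(3)[OF that] component_sym[OF assms(1)] component_trans[OF assms(1)] by blast
qed (rule component_self[OF assms(2)])

lemma ex_path:
  assumes "S \<subseteq> edges \<Phi>" "y \<in> component \<Phi> S x"
  obtains ds where "path \<Phi> S x ds y"
proof -
  have "\<exists>ds. path \<Phi> S x ds y" if "walk \<Phi> S x ds y" for ds x
    using that
  proof (induction ds arbitrary: x)
    case Nil
    then show ?case by (intro exI[of _ "[]"]) (auto simp: path_def)
  next
    case (Cons d ds)
    then obtain q where q: "path \<Phi> S (dart_head \<Phi> d) q y" by auto
    show ?case
    proof (cases "x \<in> set (dart_head \<Phi> d # map (dart_head \<Phi>) q)")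
      case False
      then have "path \<Phi> S x (d # q) y" using q Cons by (auto simp: path_def)
      then show ?thesis by blast
    next
      case True
      \<comment> \<open>When \<open>x\<close> already lies on the path, the part of the path from
        \<open>x\<close> onward is the path sought.\<close>
      have "\<exists>ds. path \<Phi> S x ds y" if "path \<Phi> S w q y" "x \<in> set (w # map (dart_head \<Phi>) q)" for q w
        using that
      proof (induction q arbitrary: w)
        case (Cons d' q')
        show ?case
        proof (cases "x = w")
          case False
          have "path \<Phi> S (dart_head \<Phi> d') q' y" "x \<in> set (dart_head \<Phi> d' # map (dart_head \<Phi>) q')"
            using Cons.prems False by (auto simp: path_def)
          then show ?thesis using Cons.IH by blast
        qed (use Cons in blast)
      qed auto
      then show ?thesis using q True by blast
    qed
  qed
  then show ?thesis using assms that by (auto simp: component_def)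
qed

section \<open>Paths, degrees and ordinary circles\<close>

text \<open>Crediting one extra degree to each end makes every visited vertex have degree 2, and
  this also covers the empty path, where both credits fall on the same vertex. The three claims are
  proved together: the first edge is new because \<open>x\<close> is touched by no later
  edge.\<close>

lemma path_degree:
  assumes "S \<subseteq> edges \<Phi>" "path \<Phi> S x ds y"
  shows "distinct (map fst ds)"
    and "touched \<Phi> (fst ` set ds) \<subseteq> insert x (dart_head \<Phi> ` set ds)"
    and "degree \<Phi> (fst ` set ds) v + of_bool (v = x) + of_bool (v = y)
      = 2 * of_bool (v \<in> insert x (dart_head \<Phi> ` set ds))"
proof -
  have "distinct (map fst ds) \<and>
    touched \<Phi> (fst ` set ds) \<subseteq> insert x (dart_head \<Phi> ` set ds) \<and>
    (\<forall>v. degree \<Phi> (fst ` set ds) v + of_bool (v = x) + of_bool (v = y)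
      = 2 * of_bool (v \<in> insert x (dart_head \<Phi> ` set ds)))"
    using assms(2)
  proof (induction ds arbitrary: x)
    case Nil
    then show ?case by (auto simp: path_def touched_def degree_def)
  next
    case (Cons d ds)
    define w where "w = dart_head \<Phi> d"
    have d: "is_ordinary (edge_of \<Phi> (fst d))" "dart_tail \<Phi> d = x"
      and p: "path \<Phi> S w ds y" and x: "x \<notin> insert w (dart_head \<Phi> ` set ds)"
      using Cons.prems by (auto simp: path_def w_def)
    note IH = Cons.IH[OF p]
    have ends: "endpoints (edge_of \<Phi> (fst d)) = {x, w}"
      using endpoints_dart[OF d(1)] d(2) by (simp add: w_def)
    have new: "fst d \<notin> fst ` set ds"
    proof
      assume "fst d \<in> fst ` set ds"
      then have "x \<in> touched \<Phi> (fst ` set ds)" unfolding touched_def using ends by blast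
      then show False using IH x by blast
    qed
    have "degree \<Phi> (fst ` set (d # ds)) v + of_bool (v = x) + of_bool (v = y)
      = 2 * of_bool (v \<in> insert x (dart_head \<Phi> ` set (d # ds)))" for v
    proof -
      have "degree \<Phi> (fst ` set (d # ds)) v
          = of_bool (v = x) + of_bool (v = w) + degree \<Phi> (fst ` set ds) v"
        using new edge_degree_dart[OF d(1)] by (simp add: degree_def d w_def)
      moreover have "degree \<Phi> (fst ` set ds) v + of_bool (v = w) + of_bool (v = y)
          = 2 * of_bool (v \<in> insert w (dart_head \<Phi> ` set ds))"
        using IH by blast
      moreover have "(2::nat) * of_bool (v \<in> insert x (dart_head \<Phi> ` set (d # ds)))
          = 2 * of_bool (v = x) + 2 * of_bool (v \<in> insert w (dart_head \<Phi> ` set ds))"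
        using x by (auto simp: w_def)
      ultimately show ?thesis by linarith
    qed
    then show ?case using IH new ends by (auto simp: touched_def w_def)
  qed
  then show "distinct (map fst ds)"
    and "touched \<Phi> (fst ` set ds) \<subseteq> insert x (dart_head \<Phi> ` set ds)"
    and "degree \<Phi> (fst ` set ds) v + of_bool (v = x) + of_bool (v = y)
      = 2 * of_bool (v \<in> insert x (dart_head \<Phi> ` set ds))"
    by blast+
qed

lemma walk_heads_component:
  assumes "S \<subseteq> edges \<Phi>" "walk \<Phi> S x ds y"
  shows "insert x (dart_head \<Phi> ` set ds) \<subseteq> component \<Phi> (fst ` set ds) x"
proof
  fix v assume v: "v \<in> insert x (dart_head \<Phi> ` set ds)"
  have x: "x \<in> verts \<Phi>" using walk_start_verts assms by blast
  show "v \<in> component \<Phi> (fst ` set ds) x"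
  proof (cases "v = x")
    case False
    then obtain d where "d \<in> set ds" "v = dart_head \<Phi> d" using v by auto
    then obtain p q where ds: "ds = (p @ [d]) @ q" by (metis append_Cons append_Nil append_assoc split_list)
    then obtain z where z: "walk \<Phi> S x (p @ [d]) z" using assms walk_append by blast
    then have "z = v" using \<open>v = _\<close> by (auto simp: walk_append[OF assms(1)])
    moreover have "walk \<Phi> (fst ` set ds) x (p @ [d]) z"
      using z by (rule walk_restrict) (auto simp: ds)
    ultimately show ?thesis by (auto simp: component_def)
  qed (use component_self x in blast)
qed

text \<open>The closing edge supplies exactly the two credits in \<open>path_degree\<close>. A loop
  is the case of an empty path.\<close>

lemma path_circle:
  assumes "S \<subseteq> edges \<Phi>" "fst d \<in> edges \<Phi>" "fst d \<notin> S" "is_ordinary (edge_of \<Phi> (fst d))"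
    and p: "path \<Phi> S (dart_head \<Phi> d) ds (dart_tail \<Phi> d)"
  shows "ordinary_circle \<Phi> (insert (fst d) (fst ` set ds))"
proof -
  define D where "D = fst ` set ds"
  define C where "C = insert (fst d) D"
  define V where "V = insert (dart_head \<Phi> d) (dart_head \<Phi> ` set ds)"
  have w: "walk \<Phi> S (dart_head \<Phi> d) ds (dart_tail \<Phi> d)" using p by (simp add: path_def)
  have D: "D \<subseteq> S" "fst d \<notin> D" "finite D" using walk_edges[OF w] assms by (auto simp: D_def)
  note deg = path_degree[OF assms(1) p, folded D_def V_def]
  have degC: "degree \<Phi> C v = 2 * of_bool (v \<in> V)" for v
    using deg(3)[of v] D edge_degree_dart[OF assms(4), of v] by (simp add: degree_def C_def)
  have C: "C \<subseteq> edges \<Phi>" using assms D by (auto simp: C_def)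
  \<comment> \<open>An unvisited tail would make the right side of the degree identity 0, while its
    left side is at least 1.\<close>
  have tail: "dart_tail \<Phi> d \<in> V" using deg(3)[of "dart_tail \<Phi> d"] by (cases "dart_tail \<Phi> d \<in> V") auto
  then have touched: "touched \<Phi> C \<subseteq> V"
    using deg(2) endpoints_dart[OF assms(4)] by (auto simp: touched_def C_def V_def)
  have "V \<subseteq> component \<Phi> D (dart_head \<Phi> d)"
    using walk_heads_component[OF assms(1) w] by (simp add: V_def D_def)
  also have "\<dots> \<subseteq> component \<Phi> C (dart_head \<Phi> d)"
    by (rule component_mono) (auto simp: C_def)
  finally have "y \<in> component \<Phi> C x" if "x \<in> V" "y \<in> V" for x y
    using that C component_eq by blast
  moreover have "is_ordinary (edge_of \<Phi> e)" if "e \<in> C" for e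
    using that assms(4) walk_ordinary[OF w] by (auto simp: C_def D_def)
  ultimately show ?thesis
    using C touched degC unfolding ordinary_circle_def C_def[symmetric] D_def[symmetric]
    by (auto simp: component_def C_def subset_iff)
qed

lemma connected_circle:
  assumes "S \<subseteq> edges \<Phi>" "e \<in> edges \<Phi>" "e \<notin> S" "edge_of \<Phi> e = Ordinary a b g"
    and "b \<in> component \<Phi> S a"
  obtains ds where "walk \<Phi> S b ds a" "distinct (map fst ds)"
    "ordinary_circle \<Phi> (insert e (fst ` set ds))"
proof -
  have d: "dart_head \<Phi> (e, True) = b" "dart_tail \<Phi> (e, True) = a"
    using assms(4) by (simp_all add: dart_head_def dart_tail_def)
  have "a \<in> component \<Phi> S b" using assms component_sym by blast
  then obtain ds where p: "path \<Phi> S b ds a" using assms ex_path by blast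
  then have "ordinary_circle \<Phi> (insert e (fst ` set ds))"
    using path_circle[of S "(e, True)" ds] assms d by simp
  then show ?thesis using that p path_degree(1)[OF assms(1) p] by (auto simp: path_def)
qed

text \<open>Handshake argument: otherwise the component of \<open>a\<close> in \<open>D - {e}\<close> would have an odd
  sum of degrees.\<close>

lemma even_degree_connected:
  assumes D: "D \<subseteq> edges \<Phi>" "\<And>f. f \<in> D \<Longrightarrow> is_ordinary (edge_of \<Phi> f)"
    and even: "\<And>v. even (degree \<Phi> D v)"
    and e: "e \<in> D" "edge_of \<Phi> e = Ordinary a b g"
  shows "b \<in> component \<Phi> (D - {e}) a"
proof (rule ccontr)
  define K where "K = component \<Phi> (D - {e}) a"
  assume "b \<notin> component \<Phi> (D - {e}) a"
  then have b: "b \<notin> K" by (simp add: K_def)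
  have a: "a \<in> K" unfolding K_def by (rule component_self) (use endpoints_verts[of e] D e in auto)
  have fin: "finite K" "finite D" unfolding K_def using finite_component finite_edge_set D by auto
  have count: "(\<Sum>v\<in>K. edge_degree (Ordinary a' b' g') v) = of_bool (a' \<in> K) + of_bool (b' \<in> K)"
    for a' b' :: 'v and g' :: 'g
    using fin by (simp add: sum.distrib of_bool_def)
  \<comment> \<open>Such an edge has both ends in \<open>K\<close> or neither, so it contributes 2
    or 0; the bridge \<open>e\<close> alone will contribute 1.\<close>
  have "even (\<Sum>v\<in>K. edge_degree (edge_of \<Phi> f) v)" if f: "f \<in> D - {e}" for f
  proof -
    obtain a' b' g' where f': "edge_of \<Phi> f = Ordinary a' b' g'"
      using is_ordinaryD[OF D(2)] f by blast
    have DE: "D - {e} \<subseteq> edges \<Phi>" using D by blast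
    have "b' \<in> component \<Phi> (D - {e}) a'" using component_edge[OF DE f f'] .
    then have "a' \<in> K \<longleftrightarrow> b' \<in> K"
      unfolding K_def using component_trans[OF DE] component_sym[OF DE] by blast
    then show ?thesis by (simp only: f' count) simp
  qed
  then have "even (\<Sum>f\<in>D - {e}. \<Sum>v\<in>K. edge_degree (edge_of \<Phi> f) v)"
    by (rule dvd_sum)
  moreover have "(\<Sum>v\<in>K. degree \<Phi> D v) = (\<Sum>f\<in>D. \<Sum>v\<in>K. edge_degree (edge_of \<Phi> f) v)"
    unfolding degree_def by (rule sum.swap)
  moreover have "\<dots> = 1 + (\<Sum>f\<in>D - {e}. \<Sum>v\<in>K. edge_degree (edge_of \<Phi> f) v)"
    using sum.remove[OF fin(2) e(1), of "\<lambda>f. \<Sum>v\<in>K. edge_degree (edge_of \<Phi> f) v"]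
    by (simp only: e(2) count) (simp add: a b)
  moreover have "even (\<Sum>v\<in>K. degree \<Phi> D v)" using even by (intro dvd_sum) auto
  ultimately show False by simp
qed

lemma ordinary_circle_degree_even:
  assumes "ordinary_circle \<Phi> C"
  shows "even (degree \<Phi> C v)"
proof (cases "v \<in> touched \<Phi> C")
  case True
  then show ?thesis using assms by (simp add: ordinary_circle_def)
next
  case False
  then have "degree \<Phi> C v = 0"
    unfolding degree_def by (intro sum.neutral) (auto simp: touched_def edge_degree_eq_0_iff)
  then show ?thesis by simp
qed

lemma ordinary_circle_connected:
  assumes "ordinary_circle \<Phi> C" "e \<in> C" "edge_of \<Phi> e = Ordinary a b g"
  shows "b \<in> component \<Phi> (C - {e}) a"
proof (rule even_degree_connected)
  show "C \<subseteq> edges \<Phi>" using assms(1) by (simp add: ordinary_circle_def)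
qed (fact assms ordinary_circle_ordinary[OF assms(1)] ordinary_circle_degree_even[OF assms(1)])+

text \<open>At each vertex it touches, \<open>C'\<close> already uses up the degree 2 available in
  \<open>C\<close>. No other edge of \<open>C\<close> can meet \<open>C'\<close>, and connectedness
  of \<open>C\<close> then excludes any further edge.\<close>

lemma ordinary_circle_minimal:
  assumes C: "ordinary_circle \<Phi> C" and C': "ordinary_circle \<Phi> C'" and sub: "C' \<subseteq> C"
  shows "C' = C"
proof (rule ccontr)
  assume "C' \<noteq> C"
  have CE: "C \<subseteq> edges \<Phi>" using C by (simp add: ordinary_circle_def)
  then have fin: "finite C" using finite_edge_set by blast
  have T: "touched \<Phi> C' \<subseteq> touched \<Phi> C" using sub by (auto simp: touched_def)
  have no: "endpoints (edge_of \<Phi> f) \<inter> touched \<Phi> C' = {}" if f: "f \<in> C - C'" for f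
  proof (rule ccontr)
    assume "\<not> ?thesis"
    then obtain x where x: "x \<in> endpoints (edge_of \<Phi> f)" "x \<in> touched \<Phi> C'" by blast
    have "degree \<Phi> C x = degree \<Phi> C' x + (\<Sum>f\<in>C - C'. edge_degree (edge_of \<Phi> f) x)"
      unfolding degree_def using sum.subset_diff[OF sub fin] by (simp add: add.commute)
    moreover have "degree \<Phi> C x = 2" "degree \<Phi> C' x = 2"
      using C C' x T by (auto simp: ordinary_circle_def)
    ultimately have "edge_degree (edge_of \<Phi> f) x = 0" using f fin by simp
    then show False using x edge_degree_eq_0_iff by metis
  qed
  obtain f where f: "f \<in> C - C'" using sub \<open>C' \<noteq> C\<close> by blast
  obtain a b g where fo: "edge_of \<Phi> f = Ordinary a b g"
    using is_ordinaryD[OF ordinary_circle_ordinary[OF C, of f]] f by blast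
  obtain e where e: "e \<in> C'" using C' by (auto simp: ordinary_circle_def)
  obtain a' b' g' where eo: "edge_of \<Phi> e = Ordinary a' b' g'"
    using is_ordinaryD[OF ordinary_circle_ordinary[OF C' e]] by blast
  have a': "a' \<in> touched \<Phi> C'" using e eo by (force simp: touched_def)
  have "component \<Phi> C a' \<subseteq> touched \<Phi> C'"
  proof (rule component_subset_closed[OF _ a'])
    fix k a b g assume k: "k \<in> C" "edge_of \<Phi> k = Ordinary a b g"
    show "a \<in> touched \<Phi> C' \<longleftrightarrow> b \<in> touched \<Phi> C'"
    proof (cases "k \<in> C'")
      case True
      then show ?thesis using k by (force simp: touched_def)
    qed (use no[of k] k in auto)
  qed
  moreover have "a \<in> touched \<Phi> C" using f fo by (force simp: touched_def)
  then have "a \<in> component \<Phi> C a'" using C a' T by (auto simp: ordinary_circle_def component_def)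
  ultimately show False using no[OF f] fo by auto
qed

text \<open>No edge \<open>e\<close> of the circle is a bridge, so a path in \<open>C - {e}\<close>
  together with \<open>e\<close> forms a circle inside \<open>C\<close>; by minimality it exhausts
  \<open>C\<close>.\<close>

lemma ordinary_circle_closed_walk:
  assumes C: "ordinary_circle \<Phi> C"
  obtains x ds where "walk \<Phi> C x ds x" "distinct (map fst ds)" "fst ` set ds = C"
proof -
  have CE: "C \<subseteq> edges \<Phi>" using C by (simp add: ordinary_circle_def)
  obtain e where e: "e \<in> C" using C by (auto simp: ordinary_circle_def)
  obtain a b g where eo: "edge_of \<Phi> e = Ordinary a b g"
    using is_ordinaryD[OF ordinary_circle_ordinary[OF C e]] by blast
  have "b \<in> component \<Phi> (C - {e}) a" by (rule ordinary_circle_connected[OF C e eo])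
  then obtain ds where ds: "walk \<Phi> (C - {e}) b ds a" "distinct (map fst ds)"
    "ordinary_circle \<Phi> (insert e (fst ` set ds))"
    using connected_circle[of "C - {e}" e a b g] CE e eo by blast
  have sub: "fst ` set ds \<subseteq> C - {e}" using walk_edges ds(1) .
  then have "insert e (fst ` set ds) = C"
    using ordinary_circle_minimal[OF C ds(3)] e by blast
  moreover have "walk \<Phi> C b ds a" using walk_mono[OF ds(1)] by blast
  then have "walk \<Phi> C a ((e, True) # ds) a"
    using e eo by (simp add: dart_head_def dart_tail_def)
  ultimately show ?thesis using that[of a "(e, True) # ds"] ds sub by auto
qed

section \<open>Balanced circles and potentials\<close>

lemma balanced_circle_walk:
  assumes C: "balanced_circle \<Phi> C" "e \<in> C" and eo: "edge_of \<Phi> e = Ordinary a b g"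
  obtains ds d where "fst d = e" "walk \<Phi> (C - {e}) (dart_head \<Phi> d) ds (dart_tail \<Phi> d)"
    "dart_gain \<Phi> d + walk_gain \<Phi> ds = 0"
proof -
  have "ordinary_circle \<Phi> C" using C eo by (auto simp: balanced_circle_def)
  then have CE: "C \<subseteq> edges \<Phi>" by (simp add: ordinary_circle_def)
  obtain x ds where ds: "walk \<Phi> C x ds x" "distinct (map fst ds)" "fst ` set ds = C"
    "walk_gain \<Phi> ds = 0"
    using C eo by (auto simp: balanced_circle_def)
  obtain d where d: "d \<in> set ds" "fst d = e" using C ds by auto
  then obtain p q where pq: "ds = p @ d # q" by (meson split_list)
  have "walk \<Phi> C x p (dart_tail \<Phi> d)" "walk \<Phi> C (dart_head \<Phi> d) q x"
    using ds(1) unfolding pq walk_append[OF CE] by auto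
  then have "walk \<Phi> C (dart_head \<Phi> d) (q @ p) (dart_tail \<Phi> d)"
    using walk_append[OF CE] by blast
  then have "walk \<Phi> (C - {e}) (dart_head \<Phi> d) (q @ p) (dart_tail \<Phi> d)"
  proof (rule walk_restrict)
    have "fst ` set (q @ p) \<subseteq> C" using ds(3) pq by auto
    moreover have "e \<notin> fst ` set (q @ p)" using ds(2) unfolding pq d(2)[symmetric] by auto
    ultimately show "fst ` set (q @ p) \<subseteq> C - {e}" by blast
  qed
  moreover have "walk_gain \<Phi> p + (dart_gain \<Phi> d + walk_gain \<Phi> q) = 0"
    using ds(4) pq by simp
  \<comment> \<open>Rotating the closed walk to start at \<open>d\<close> conjugates its gain, and a
    conjugate of \<open>0\<close> is \<open>0\<close> even in a noncommutative group.\<close>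
  then have "dart_gain \<Phi> d + walk_gain \<Phi> (q @ p) = 0"
    using minus_unique[of "walk_gain \<Phi> p"] by (metis add.assoc left_minus walk_gain_simps(3))
  ultimately show ?thesis using that d by blast
qed

text \<open>The walk around the rest of the circle has the gain inverse to that of the traversed
  \<open>e\<close>, so a potential on the rest is forced to respect \<open>e\<close> as
  well.\<close>

lemma potential_balanced_circle:
  assumes C: "balanced_circle \<Phi> C" "e \<in> C" and eo: "edge_of \<Phi> e = Ordinary a b g"
    and p: "potential \<Phi> (C - {e}) p"
  shows "p b = p a + g"
proof -
  obtain ds d where d: "fst d = e" "walk \<Phi> (C - {e}) (dart_head \<Phi> d) ds (dart_tail \<Phi> d)"
    "dart_gain \<Phi> d + walk_gain \<Phi> ds = 0"
    using balanced_circle_walk[OF C eo] by blast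
  have "p (dart_tail \<Phi> d) = p (dart_head \<Phi> d) + walk_gain \<Phi> ds"
    by (rule potential_walk[OF p d(2)])
  moreover have "walk_gain \<Phi> ds = - dart_gain \<Phi> d" using minus_unique[OF d(3)] by simp
  ultimately show ?thesis
    using d(1) eo by (cases "snd d") (auto simp: dart_tail_def dart_head_def dart_gain_def algebra_simps)
qed

text \<open>Around a closed walk the potential returns to its initial value, so cancellation leaves
  gain \<open>0\<close>. Half edges must be excluded separately, since a potential does not see
  them.\<close>

lemma potential_imp_balanced:
  assumes S: "S \<subseteq> edges \<Phi>" "\<And>e. e \<in> S \<Longrightarrow> \<not> is_half (edge_of \<Phi> e)"
    and p: "potential \<Phi> S p"
  shows "balanced \<Phi> S"
  unfolding balanced_def
proof (intro conjI ballI allI impI S(2))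
  fix C assume C: "C \<subseteq> S" "circle \<Phi> C"
  show "balanced_circle \<Phi> C"
  proof (cases "ordinary_circle \<Phi> C")
    case True
    then obtain x ds where ds: "walk \<Phi> C x ds x" "distinct (map fst ds)" "fst ` set ds = C"
      using ordinary_circle_closed_walk by blast
    have "p x = p x + walk_gain \<Phi> ds"
      using potential_walk[OF p walk_mono[OF ds(1) C(1)]] .
    then have "walk_gain \<Phi> ds = 0" by (metis add.right_neutral add_left_imp_eq)
    then show ?thesis using True ds by (auto simp: balanced_circle_def)
  next
    case False
    then obtain e where e: "e \<in> edges \<Phi>" "C = {e}" "\<not> is_ordinary (edge_of \<Phi> e)"
      using circle_singleton[OF C(2)] by blast
    then have "edge_of \<Phi> e = Loose" using S(2)[of e] C by (cases "edge_of \<Phi> e") auto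
    then show ?thesis using e by (auto simp: balanced_circle_def)
  qed
qed

section \<open>Spanning forests and fundamental circles\<close>

lemma spanning_forest_disconnected:
  assumes F: "F \<in> spanning_forests \<Phi>" and e: "e \<in> F" "edge_of \<Phi> e = Ordinary a b g"
  shows "b \<notin> component \<Phi> (F - {e}) a"
proof
  have FE: "F \<subseteq> edges \<Phi>" by (rule spanning_forest_edges[OF F])
  assume "b \<in> component \<Phi> (F - {e}) a"
  then obtain ds where ds: "walk \<Phi> (F - {e}) b ds a"
      "ordinary_circle \<Phi> (insert e (fst ` set ds))"
    using connected_circle[of "F - {e}" e a b g] FE e by blast
  then have "insert e (fst ` set ds) \<subseteq> F" using walk_edges[OF ds(1)] e by blast
  then show False using spanning_forest_no_circle[OF F] ds by (auto simp: circle_def)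
qed

text \<open>For ordinary \<open>e\<close>, both circles contain \<open>e\<close>, so their symmetric
  difference lies in \<open>F\<close> and has even degrees. If it were nonempty, one of its edges
  would have its ends joined by the others, which is impossible in a forest.\<close>

lemma unique_circle:
  assumes F: "F \<in> spanning_forests \<Phi>"
    and C: "C \<subseteq> insert e F" "circle \<Phi> C" and C': "C' \<subseteq> insert e F" "circle \<Phi> C'"
  shows "C = C'"
proof (cases "is_ordinary (edge_of \<Phi> e)")
  case False
  have "C = {e}" if "C \<subseteq> insert e F" "circle \<Phi> C" for C
  proof -
    have "e \<in> C" using that spanning_forest_no_circle[OF F, of C] by blast
    then have "\<not> ordinary_circle \<Phi> C" using False ordinary_circle_ordinary[of \<Phi> C e] by blast
    from circle_singleton[OF that(2) this] show ?thesis using \<open>e \<in> C\<close> by blast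
  qed
  then show ?thesis using assms by blast
next
  case True
  have ord: "is_ordinary (edge_of \<Phi> f)" if "f \<in> insert e F" for f
    using that True spanning_forest_ordinary[OF F] by auto
  have oc: "ordinary_circle \<Phi> C \<and> e \<in> C" if "C \<subseteq> insert e F" "circle \<Phi> C" for C
    using that ord spanning_forest_no_circle[OF F, of C] circle_singleton[OF that(2)]
    by blast
  define D where "D = (C - C') \<union> (C' - C)"
  have D: "D \<subseteq> F" using assms oc by (auto simp: D_def)
  have CE: "finite C" "finite C'"
    using oc[OF C] oc[OF C'] finite_edge_set by (auto simp: ordinary_circle_def)
  have "even (degree \<Phi> D v)" for v
  proof -
    have "degree \<Phi> D v = degree \<Phi> (C - C') v + degree \<Phi> (C' - C) v"
      unfolding degree_def D_def using CE by (intro sum.union_disjoint) auto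
    moreover have "degree \<Phi> C v = degree \<Phi> (C - C') v + degree \<Phi> (C \<inter> C') v"
      unfolding degree_def using CE sum.Int_Diff[of C _ C'] by (simp add: add.commute)
    moreover have "degree \<Phi> C' v = degree \<Phi> (C' - C) v + degree \<Phi> (C \<inter> C') v"
      unfolding degree_def using CE sum.Int_Diff[of C' _ C] by (simp add: add.commute Int_commute)
    moreover have "even (degree \<Phi> C v)" "even (degree \<Phi> C' v)"
      using oc assms ordinary_circle_degree_even by blast+
    ultimately show ?thesis by presburger
  qed
  note ev = this
  have "D = {}"
  proof (rule ccontr)
    assume "D \<noteq> {}"
    then obtain f where f: "f \<in> D" by blast
    then obtain a b g where fo: "edge_of \<Phi> f = Ordinary a b g"
      using is_ordinaryD[OF ord, of f] D by blast
    have "b \<in> component \<Phi> (D - {f}) a"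
      by (rule even_degree_connected[OF _ _ ev f fo])
         (use D spanning_forest_edges[OF F] ord in blast)+
    moreover have "D \<in> spanning_forests \<Phi>" using spanning_forest_subset F D .
    ultimately show False using spanning_forest_disconnected f fo by blast
  qed
  then show ?thesis by (auto simp: D_def)
qed

lemma fundamental_circle_eq:
  assumes "F \<in> spanning_forests \<Phi>" "C \<subseteq> insert e F" "circle \<Phi> C"
  shows "fundamental_circle \<Phi> F e = C"
  unfolding fundamental_circle_def
proof (rule the_equality)
  show "C' = C" if "C' \<subseteq> insert e F \<and> circle \<Phi> C'" for C'
    by (rule unique_circle[OF assms(1)]) (use that assms in blast)+
qed (simp add: assms)

lemma component_insert_edge:
  assumes F: "insert e F \<subseteq> edges \<Phi>" and eo: "edge_of \<Phi> e = Ordinary a b g" and x: "x \<in> verts \<Phi>"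
  shows "component \<Phi> (insert e F) x = (if x \<in> component \<Phi> F a \<union> component \<Phi> F b
    then component \<Phi> F a \<union> component \<Phi> F b else component \<Phi> F x)"
proof -
  have FE: "F \<subseteq> edges \<Phi>" using F by blast
  have mono: "component \<Phi> F y \<subseteq> component \<Phi> (insert e F) y" for y
    by (rule component_mono) blast
  have ab: "a \<in> verts \<Phi>" "b \<in> verts \<Phi>" using endpoints_verts[of e] F eo by auto
  have b: "b \<in> component \<Phi> (insert e F) a" using component_edge[OF F _ eo] by simp
  have cl: "a' \<in> component \<Phi> F y \<longleftrightarrow> b' \<in> component \<Phi> F y"
    if "f \<in> F" "edge_of \<Phi> f = Ordinary a' b' g'" for f a' b' g' y
    using component_edge[OF FE that] component_sym[OF FE] component_trans[OF FE] by blast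
  show ?thesis
  proof (cases "x \<in> component \<Phi> F a \<union> component \<Phi> F b")
    case True
    have "component \<Phi> (insert e F) x \<subseteq> component \<Phi> F a \<union> component \<Phi> F b"
      by (rule component_subset_closed) (use True cl eo component_self ab in auto)
    moreover have "component \<Phi> F a \<union> component \<Phi> F b \<subseteq> component \<Phi> (insert e F) a"
      using mono[of a] mono[of b] component_eq[OF F b] by blast
    moreover have "component \<Phi> (insert e F) x = component \<Phi> (insert e F) a"
      using component_eq[OF F] True calculation(2) by blast
    ultimately show ?thesis using True by auto
  next
    case False
    have "component \<Phi> (insert e F) x \<subseteq> component \<Phi> F x"
    proof (rule component_subset_closed)
      fix f a' b' g' assume f: "f \<in> insert e F" "edge_of \<Phi> f = Ordinary a' b' g'"
      have "a \<notin> component \<Phi> F x" "b \<notin> component \<Phi> F x"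
        using False component_sym[OF FE] by blast+
      then show "a' \<in> component \<Phi> F x \<longleftrightarrow> b' \<in> component \<Phi> F x"
        using f eo cl by (cases "f = e") auto
    qed (rule component_self[OF x])
    then show ?thesis using False mono[of x] by auto
  qed
qed

lemma card_components_insert_edge:
  assumes F: "insert e F \<subseteq> edges \<Phi>" and eo: "edge_of \<Phi> e = Ordinary a b g"
    and b: "b \<notin> component \<Phi> F a"
  shows "Suc (card (components \<Phi> (insert e F))) = card (components \<Phi> F)"
proof -
  define A where "A = component \<Phi> F a"
  define B where "B = component \<Phi> F b"
  have FE: "F \<subseteq> edges \<Phi>" using F by blast
  have ab: "a \<in> verts \<Phi>" "b \<in> verts \<Phi>" using endpoints_verts[of e] F eo by auto
  have AB: "A \<in> components \<Phi> F" "B \<in> components \<Phi> F" "a \<in> A" "b \<in> B" "A \<noteq> B"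
    using ab b component_self by (auto simp: A_def B_def components_def)
  have eqA: "component \<Phi> F x = A" if "x \<in> A" for x using component_eq[OF FE] that by (simp add: A_def)
  have eqB: "component \<Phi> F x = B" if "x \<in> B" for x using component_eq[OF FE] that by (simp add: B_def)
  have ins: "component \<Phi> (insert e F) x = (if x \<in> A \<union> B then A \<union> B else component \<Phi> F x)"
    if "x \<in> verts \<Phi>" for x
    using component_insert_edge[OF F eo that] by (simp add: A_def B_def)
  have "components \<Phi> (insert e F) = insert (A \<union> B) (components \<Phi> F - {A, B})"
  proof (intro equalityI subsetI)
    fix W assume "W \<in> components \<Phi> (insert e F)"
    then obtain x where x: "x \<in> verts \<Phi>" "W = component \<Phi> (insert e F) x"
      by (auto simp: components_def)
    show "W \<in> insert (A \<union> B) (components \<Phi> F - {A, B})"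
      using ins[OF x(1)] x component_self[OF x(1), of F] by (auto simp: components_def)
  next
    fix W assume "W \<in> insert (A \<union> B) (components \<Phi> F - {A, B})"
    then consider "W = A \<union> B" | x where "x \<in> verts \<Phi>" "W = component \<Phi> F x" "W \<noteq> A" "W \<noteq> B"
      by (auto simp: components_def)
    then show "W \<in> components \<Phi> (insert e F)"
    proof cases
      case 1
      then show ?thesis using ins[OF ab(1)] AB ab by (auto simp: components_def)
    next
      case 2
      then have "W = component \<Phi> (insert e F) x" using ins[OF 2(1)] eqA eqB by auto
      then show ?thesis using 2 by (auto simp: components_def)
    qed
  qed
  moreover have fin: "finite (components \<Phi> F)" using finite_verts by (simp add: components_def)
  \<comment> \<open>If the union were a component of \<open>F\<close>, it would be the component of
    \<open>a\<close>, that is \<open>A\<close>, which has been removed. Hence the insertion really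
    adds one element.\<close>
  moreover have "A \<union> B \<notin> components \<Phi> F - {A, B}"
  proof
    assume AB': "A \<union> B \<in> components \<Phi> F - {A, B}"
    then obtain x where "A \<union> B = component \<Phi> F x" by (auto simp: components_def)
    then have "A = A \<union> B" using component_eq[OF FE, of a x] AB(3) unfolding A_def by blast
    then show False using AB' by blast
  qed
  ultimately have "card (components \<Phi> (insert e F)) = Suc (card (components \<Phi> F - {A, B}))"
    by simp
  moreover have "card (components \<Phi> F - {A, B}) = card (components \<Phi> F) - 2"
    using AB fin by (subst card_Diff_subset) auto
  \<comment> \<open>There are at least two components, so the subtraction of 2 above does not
    truncate.\<close>
  moreover have "card {A, B} \<le> card (components \<Phi> F)" using AB fin by (intro card_mono) auto
  ultimately show ?thesis using AB by simp
qed

text \<open>Both claims rest on one fact: a new forest edge joins two distinct components. The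
  number of components drops by one, and the potential on one of the two can still be shifted
  freely.\<close>

lemma spanning_forest_card_potential:
  assumes "F \<in> spanning_forests \<Phi>"
  shows "card F + card (components \<Phi> F) = card (verts \<Phi>) \<and> (\<exists>p. potential \<Phi> F p)"
proof -
  have "finite F" using spanning_forest_edges[OF assms] finite_edge_set by blast
  then show ?thesis using assms
  proof (induction F rule: finite_induct)
    case empty
    have "component \<Phi> {} x = {x}" if "x \<in> verts \<Phi>" for x
      using component_subset_closed[of "{}" \<Phi> "{x}" x] component_self[OF that] by auto
    then have "components \<Phi> {} = (\<lambda>x. {x}) ` verts \<Phi>" by (auto simp: components_def)
    then have "card (components \<Phi> {}) = card (verts \<Phi>)" by (simp add: card_image)
    then show ?case by (simp add: potential_def)
  next
    case (insert e F)
    have F: "F \<in> spanning_forests \<Phi>"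
      using spanning_forest_subset[OF insert.prems, of F] by blast
    have FE: "insert e F \<subseteq> edges \<Phi>" "F \<subseteq> edges \<Phi>" using spanning_forest_edges[OF insert.prems] by auto
    obtain a b g where eo: "edge_of \<Phi> e = Ordinary a b g"
      using is_ordinaryD[OF spanning_forest_ordinary[OF insert.prems, of e]] by blast
    have b: "b \<notin> component \<Phi> F a"
      using spanning_forest_disconnected[OF insert.prems _ eo] insert.hyps by simp
    have ab: "a \<in> verts \<Phi>" "b \<in> verts \<Phi>" using endpoints_verts[of e] FE eo by auto
    obtain p where p: "potential \<Phi> F p" using insert.IH F by blast
    \<comment> \<open>The left translation is chosen to give \<open>b\<close> the value
      \<open>p a + g\<close>; it leaves all relations inside the component of \<open>b\<close>
      intact.\<close>
    define p' where "p' x = (if x \<in> component \<Phi> F b then p a + g - p b + p x else p x)" for x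
    have "potential \<Phi> (insert e F) p'"
      unfolding potential_def
    proof (intro ballI allI impI)
      fix f a' b' g' assume f: "f \<in> insert e F" "edge_of \<Phi> f = Ordinary a' b' g'"
      show "p' b' = p' a' + g'"
      proof (cases "f = e")
        case True
        have "a \<notin> component \<Phi> F b" using b component_sym[OF FE(2)] by blast
        then show ?thesis using True f eo component_self[OF ab(2), of F] by (simp add: p'_def)
      next
        case False
        then have f': "f \<in> F" using f by blast
        have "a' \<in> component \<Phi> F b \<longleftrightarrow> b' \<in> component \<Phi> F b"
          using component_edge[OF FE(2) f' f(2)] component_sym[OF FE(2)] component_trans[OF FE(2)]
          by blast
        moreover have "p b' = p a' + g'" using p f f' by (auto simp: potential_def)
        ultimately show ?thesis by (simp add: p'_def add.assoc)
      qed
    qed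
    then show ?case
      using insert.IH[OF F] insert.hyps card_components_insert_edge[OF FE(1) eo b] by auto
  qed
qed

section \<open>Balance checked component by component\<close>

text \<open>Half edges and ordinary circles each sit inside one component. Loose edges belong to no
  \<open>component_edges\<close>, which is harmless because they are balanced circles.\<close>

lemma balanced_components_eq_components_iff:
  assumes S: "S \<subseteq> edges \<Phi>"
  shows "balanced_components \<Phi> S = components \<Phi> S \<longleftrightarrow> balanced \<Phi> S"
proof
  assume "balanced \<Phi> S"
  then have "balanced \<Phi> (component_edges \<Phi> S W)" for W
    unfolding balanced_def component_edges_def by blast
  then show "balanced_components \<Phi> S = components \<Phi> S" by (auto simp: balanced_components_def)
next
  assume eq: "balanced_components \<Phi> S = components \<Phi> S"
  have bal: "balanced \<Phi> (component_edges \<Phi> S (component \<Phi> S x))" if "x \<in> verts \<Phi>" for x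
  proof -
    have "component \<Phi> S x \<in> balanced_components \<Phi> S" using eq that by (simp add: components_def)
    then show ?thesis by (simp add: balanced_components_def)
  qed
  have half: "\<not> is_half (edge_of \<Phi> e)" if e: "e \<in> S" for e
  proof
    assume "is_half (edge_of \<Phi> e)"
    then obtain x where x: "edge_of \<Phi> e = Half x" by (cases "edge_of \<Phi> e") auto
    then have xv: "x \<in> verts \<Phi>" using endpoints_verts[of e] S e by auto
    then have "e \<in> component_edges \<Phi> S (component \<Phi> S x)"
      using x e component_self[OF xv] by (simp add: component_edges_def)
    then show False using bal[OF xv] x by (auto simp: balanced_def)
  qed
  moreover have "balanced_circle \<Phi> C" if C: "C \<subseteq> S" "circle \<Phi> C" for C
  proof (cases "ordinary_circle \<Phi> C")
    case True
    then obtain e where e: "e \<in> C" by (auto simp: ordinary_circle_def)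
    obtain a b g where eo: "edge_of \<Phi> e = Ordinary a b g"
      using is_ordinaryD[OF ordinary_circle_ordinary[OF True e]] by blast
    have a: "a \<in> touched \<Phi> C" using e eo by (force simp: touched_def)
    have av: "a \<in> verts \<Phi>" using endpoints_verts[of e] S C e eo by auto
    have "C \<subseteq> component_edges \<Phi> S (component \<Phi> S a)"
    proof
      fix f assume f: "f \<in> C"
      obtain a' b' g' where fo: "edge_of \<Phi> f = Ordinary a' b' g'"
        using is_ordinaryD[OF ordinary_circle_ordinary[OF True f]] by blast
      have "a' \<in> touched \<Phi> C" using f fo by (force simp: touched_def)
      then have "a' \<in> component \<Phi> C a" using True a by (auto simp: ordinary_circle_def component_def)
      then have "a' \<in> component \<Phi> S a" using component_mono[OF C(1)] by blast
      then show "f \<in> component_edges \<Phi> S (component \<Phi> S a)"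
        using f C fo by (auto simp: component_edges_def)
    qed
    then show ?thesis using bal[OF av] C(2) unfolding balanced_def by blast
  next
    case False
    then obtain e where e: "e \<in> edges \<Phi>" "C = {e}" "\<not> is_ordinary (edge_of \<Phi> e)"
      using circle_singleton[OF C(2)] by blast
    then have "edge_of \<Phi> e = Loose" using half[of e] C by (cases "edge_of \<Phi> e") auto
    then show ?thesis using e by (auto simp: balanced_circle_def)
  qed
  ultimately show "balanced \<Phi> S" unfolding balanced_def by blast
qed

text \<open>The left side is the exponent of \<open>z\<close>: at \<open>z = 0\<close> a term
  survives exactly when this exponent is 0.\<close>

lemma card_balanced_components_iff:
  assumes S: "S \<subseteq> edges \<Phi>"
  shows "card (components \<Phi> S) - card (balanced_components \<Phi> S) = 0 \<longleftrightarrow> balanced \<Phi> S"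
proof -
  have "finite (components \<Phi> S)" using finite_verts by (simp add: components_def)
  moreover have "balanced_components \<Phi> S \<subseteq> components \<Phi> S" by (auto simp: balanced_components_def)
  ultimately show ?thesis
    using card_seteq[of "components \<Phi> S" "balanced_components \<Phi> S"]
      balanced_components_eq_components_iff[OF S] by auto
qed

text \<open>Frees \<open>path_gain\<close> from its choice of a path.\<close>

lemma path_gain_potential:
  assumes "S \<subseteq> edges \<Phi>" "potential \<Phi> S p" "y \<in> component \<Phi> S x"
  shows "path_gain \<Phi> S x y = - p x + p y"
proof -
  have "\<exists>ds. path \<Phi> S x ds y" using ex_path assms by blast
  then have "path \<Phi> S x (SOME ds. path \<Phi> S x ds y) y" by (rule someI_ex)
  then have "p y = p x + path_gain \<Phi> S x y"
    using potential_walk[OF assms(2)] by (simp add: path_def path_gain_def)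
  then show ?thesis by (simp add: add.assoc[symmetric])
qed

lemma component_outside:
  assumes "S \<subseteq> edges \<Phi>" "x \<notin> verts \<Phi>"
  shows "component \<Phi> S x = {}"
  unfolding component_def using walk_start_verts[OF assms(1)] assms(2) by blast

end

section \<open>Edge order and greedy forests\<close>

definition below :: "'e rel \<Rightarrow> 'e set \<Rightarrow> 'e \<Rightarrow> 'e set" where
  "below R S e = {f \<in> S. (f, e) \<in> R \<and> f \<noteq> e}"

lemma below_mono: "S \<subseteq> T \<Longrightarrow> below R S e \<subseteq> below R T e"
  by (auto simp: below_def)

lemma below_subset: "below R S e \<subseteq> S"
  by (auto simp: below_def)

text \<open>The lexicographically smallest maximal forest contained in \<open>S\<close>, as produced by
  Kruskal's algorithm.\<close>

definition greedy_forest :: "('v, 'e, 'g) gain_graph \<Rightarrow> 'e rel \<Rightarrow> 'e set \<Rightarrow> 'e set" where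
  "greedy_forest \<Phi> R S =
     {e \<in> S. \<exists>a b g. edge_of \<Phi> e = Ordinary a b g \<and> b \<notin> component \<Phi> (below R S e) a}"

locale ordered_gain_graph = finite_gain_graph \<Phi>
  for \<Phi> :: "('v, 'e, 'g::group_add) gain_graph" +
  fixes R :: "'e rel"
  assumes linear: "linear_order_on (edges \<Phi>) R"
begin

lemma order_facts:
  "trans R" "antisym R" "e \<in> edges \<Phi> \<Longrightarrow> (e, e) \<in> R"
  "e \<in> edges \<Phi> \<Longrightarrow> f \<in> edges \<Phi> \<Longrightarrow> (e, f) \<in> R \<or> (f, e) \<in> R"
proof -
  have *: "refl_on (edges \<Phi>) R" "total_on (edges \<Phi>) R" "trans R" "antisym R"
    using linear by (simp_all add: linear_order_on_def partial_order_on_def preorder_on_def)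
  show "trans R" "antisym R" by (fact *)+
  show "e \<in> edges \<Phi> \<Longrightarrow> (e, e) \<in> R" by (rule refl_onD[OF *(1)])
  then show "e \<in> edges \<Phi> \<Longrightarrow> f \<in> edges \<Phi> \<Longrightarrow> (e, f) \<in> R \<or> (f, e) \<in> R"
    using *(2) by (cases "e = f") (auto simp: total_on_def)
qed

lemma ex_greatest:
  assumes "C \<subseteq> edges \<Phi>" "C \<noteq> {}"
  shows "\<exists>e\<in>C. \<forall>f\<in>C. (f, e) \<in> R"
proof -
  have "finite C" using assms finite_edge_set by blast
  then show ?thesis using assms(2,1)
  proof (induction C rule: finite_ne_induct)
    case (singleton x)
    then show ?case using order_facts(3) by auto
  next
    case (insert x C)
    then obtain e where e: "e \<in> C" "\<forall>f\<in>C. (f, e) \<in> R" by auto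
    have "(x, x) \<in> R" "(x, e) \<in> R \<or> (e, x) \<in> R"
      using order_facts(3,4) insert.prems e(1) by blast+
    then show ?case using e transD[OF order_facts(1)] by blast
  qed
qed

lemma below_below:
  assumes "f \<in> below R S e"
  shows "below R T f \<subseteq> below R T e"
  using assms transD[OF order_facts(1)] antisymD[OF order_facts(2)] unfolding below_def by blast

text \<open>A rejected edge \<open>f\<close> has its ends joined by smaller edges of
  \<open>S\<close>, hence by induction by smaller edges of \<open>F\<close>, and these also precede
  \<open>e\<close>. \<open>F\<close> is kept general so that the result serves both for a greedy
  forest in \<open>S\<close> and for a forest enlarged by active edges.\<close>

lemma component_below_subset:
  assumes F: "F \<subseteq> S" and S: "S \<subseteq> edges \<Phi>"
    and red: "\<And>f a b g. f \<in> S - F \<Longrightarrow> edge_of \<Phi> f = Ordinary a b g \<Longrightarrow>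
      b \<in> component \<Phi> (below R S f) a"
    and x: "x \<in> verts \<Phi>"
  shows "component \<Phi> (below R S e) x \<subseteq> component \<Phi> (below R F e) x"
  using x
proof (induction "card (below R S e)" arbitrary: e x rule: less_induct)
  case less
  have FE: "below R F e \<subseteq> edges \<Phi>" for e using F S below_subset[of R F e] by blast
  show ?case
  proof (rule component_subset_component[OF FE less.prems])
    fix f a b g assume f: "f \<in> below R S e" and fo: "edge_of \<Phi> f = Ordinary a b g"
    show "b \<in> component \<Phi> (below R F e) a"
    proof (cases "f \<in> F")
      case True
      then have "f \<in> below R F e" using f by (simp add: below_def)
      then show ?thesis using component_edge[OF FE] fo by blast
    next
      case False
      have fS: "f \<in> S" using f by (simp add: below_def)
      have "f \<notin> below R S f" by (simp add: below_def)
      \<comment> \<open>The inclusion is strict because \<open>f\<close> itself precedes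
        \<open>e\<close> but not \<open>f\<close>, so the induction measure drops.\<close>
      then have "below R S f \<subset> below R S e" using below_below[OF f] f by blast
      moreover have "finite (below R S e)"
        by (rule finite_subset[OF below_subset finite_edge_set[OF S]])
      ultimately have "card (below R S f) < card (below R S e)" by (rule psubset_card_mono[rotated])
      moreover have "a \<in> verts \<Phi>" using endpoints_verts[of f] fS S fo by auto
      ultimately have "component \<Phi> (below R S f) a \<subseteq> component \<Phi> (below R F f) a"
        using less.hyps by blast
      moreover have "b \<in> component \<Phi> (below R S f) a" using red False fS fo by blast
      ultimately show ?thesis using component_mono[OF below_below[OF f, of F]] by blast
    qed
  qed
qed

lemma greedy_forest_subset: "greedy_forest \<Phi> R S \<subseteq> S"
  by (auto simp: greedy_forest_def)

text \<open>The largest edge of a circle has its ends joined by the other edges of the circle, all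
  smaller, so the greedy choice would have rejected it.\<close>

lemma greedy_forest_spanning:
  assumes S: "S \<subseteq> edges \<Phi>"
  shows "greedy_forest \<Phi> R S \<in> spanning_forests \<Phi>"
  unfolding spanning_forests_def
proof (intro CollectI conjI notI)
  show "greedy_forest \<Phi> R S \<subseteq> edges \<Phi>" using S greedy_forest_subset by blast
  assume "\<exists>C\<subseteq>greedy_forest \<Phi> R S. circle \<Phi> C"
  then obtain C where C: "C \<subseteq> greedy_forest \<Phi> R S" "circle \<Phi> C" by blast
  have "is_ordinary (edge_of \<Phi> e)" if "e \<in> C" for e
    using that C(1) by (auto simp: greedy_forest_def)
  then have oc: "ordinary_circle \<Phi> C" using circle_singleton[OF C(2)] by blast
  then have "C \<subseteq> edges \<Phi>" "C \<noteq> {}" by (auto simp: ordinary_circle_def)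
  then obtain e where e: "e \<in> C" "\<forall>f\<in>C. (f, e) \<in> R" using ex_greatest by blast
  then obtain a b g where eo: "edge_of \<Phi> e = Ordinary a b g"
    and b: "b \<notin> component \<Phi> (below R S e) a"
    using C(1) by (auto simp: greedy_forest_def)
  have "C - {e} \<subseteq> below R S e" using e C(1) greedy_forest_subset by (auto simp: below_def)
  then show False
    using ordinary_circle_connected[OF oc e(1) eo] b component_mono by blast
qed

section \<open>Externally active edges\<close>

text \<open>Uniqueness of the circle in \<open>insert e F\<close> turns the definite description in
  \<open>fundamental_circle\<close> into an existential statement.\<close>

lemma externally_active_iff:
  assumes F: "F \<in> spanning_forests \<Phi>"
  shows "e \<in> externally_active \<Phi> R F \<longleftrightarrow> e \<in> edges \<Phi> - F \<and>
    (\<exists>C\<subseteq>insert e F. balanced_circle \<Phi> C \<and> e \<in> C \<and> (\<forall>f\<in>C. (f, e) \<in> R))"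
proof -
  have "fundamental_circle \<Phi> F e = C" if "C \<subseteq> insert e F" "balanced_circle \<Phi> C" for C
    using fundamental_circle_eq[OF F that(1) balanced_circle_imp_circle[OF that(2)]] .
  then show ?thesis unfolding externally_active_def clos_def by blast
qed

text \<open>The rest of the fundamental circle consists of smaller forest edges. This is the reason
  the greedy choice rejects \<open>e\<close>.\<close>

lemma externally_active_connected:
  assumes F: "F \<in> spanning_forests \<Phi>" and e: "e \<in> externally_active \<Phi> R F"
    and eo: "edge_of \<Phi> e = Ordinary a b g"
  shows "b \<in> component \<Phi> (below R F e) a"
proof -
  obtain C where C: "C \<subseteq> insert e F" "balanced_circle \<Phi> C" "e \<in> C" "\<forall>f\<in>C. (f, e) \<in> R"
    using e externally_active_iff[OF F] by blast
  have "ordinary_circle \<Phi> C" using C eo by (auto simp: balanced_circle_def)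
  then have "b \<in> component \<Phi> (C - {e}) a" using ordinary_circle_connected C eo by blast
  moreover have "C - {e} \<subseteq> below R F e" using C by (auto simp: below_def)
  ultimately show ?thesis using component_mono by blast
qed

lemma externally_active_potential:
  assumes F: "F \<in> spanning_forests \<Phi>" and e: "e \<in> externally_active \<Phi> R F"
    and eo: "edge_of \<Phi> e = Ordinary a b g" and p: "potential \<Phi> F p"
  shows "p b = p a + g"
proof -
  obtain C where C: "C \<subseteq> insert e F" "balanced_circle \<Phi> C" "e \<in> C"
    using e externally_active_iff[OF F] by blast
  have "potential \<Phi> (C - {e}) p" using p C(1) unfolding potential_def by blast
  then show ?thesis using potential_balanced_circle C eo by blast
qed

lemma externally_active_not_half:
  assumes F: "F \<in> spanning_forests \<Phi>" and e: "e \<in> externally_active \<Phi> R F"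
  shows "\<not> is_half (edge_of \<Phi> e)"
proof -
  obtain C where "balanced_circle \<Phi> C" "e \<in> C"
    using e externally_active_iff[OF F] by blast
  then have "is_ordinary (edge_of \<Phi> e) \<or> edge_of \<Phi> e = Loose"
    using ordinary_circle_ordinary[of \<Phi> C e] by (auto simp: balanced_circle_def)
  then show ?thesis by (cases "edge_of \<Phi> e") auto
qed

text \<open>The ends of a rejected ordinary edge are joined by smaller edges of \<open>S\<close>,
  hence by smaller edges of the greedy forest. Closing such a path with the edge gives a circle in
  \<open>S\<close>, balanced because \<open>S\<close> is, whose largest element is that
  edge.\<close>

lemma greedy_forest_externally_active:
  assumes S: "S \<subseteq> edges \<Phi>" "balanced \<Phi> S"
  shows "S - greedy_forest \<Phi> R S \<subseteq> externally_active \<Phi> R (greedy_forest \<Phi> R S)"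
proof
  fix e assume e: "e \<in> S - greedy_forest \<Phi> R S"
  define F where "F = greedy_forest \<Phi> R S"
  have F: "F \<in> spanning_forests \<Phi>" "F \<subseteq> S"
    unfolding F_def using greedy_forest_spanning[OF S(1)] greedy_forest_subset by auto
  have eE: "e \<in> edges \<Phi> - F" using e S by (auto simp: F_def)
  have "\<exists>C\<subseteq>insert e F. balanced_circle \<Phi> C \<and> e \<in> C \<and> (\<forall>f\<in>C. (f, e) \<in> R)"
  proof (cases "edge_of \<Phi> e")
    case (Ordinary a b g)
    have red: "b \<in> component \<Phi> (below R S f) a"
      if "f \<in> S - F" "edge_of \<Phi> f = Ordinary a b g" for f a b g
      using that by (auto simp: F_def greedy_forest_def)
    have a: "a \<in> verts \<Phi>" using endpoints_verts[of e] eE Ordinary by auto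
    have "component \<Phi> (below R S e) a \<subseteq> component \<Phi> (below R F e) a"
      by (rule component_below_subset[OF F(2) S(1) _ a]) (erule (1) red)
    then have b: "b \<in> component \<Phi> (below R F e) a"
      using red e Ordinary unfolding F_def by blast
    have "below R F e \<subseteq> edges \<Phi>" "e \<notin> below R F e"
      using F(2) S(1) by (auto simp: below_def)
    then obtain ds where ds: "walk \<Phi> (below R F e) b ds a"
      "ordinary_circle \<Phi> (insert e (fst ` set ds))"
      using connected_circle[of "below R F e" e a b g] eE Ordinary b by blast
    define C where "C = insert e (fst ` set ds)"
    have C: "C - {e} \<subseteq> below R F e" "e \<in> C" using walk_edges[OF ds(1)] by (auto simp: C_def)
    have "C \<subseteq> S" using C F(2) e by (auto simp: below_def)
    then have "balanced_circle \<Phi> C"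
      using S(2) ds(2) by (simp add: balanced_def circle_def C_def)
    moreover have "\<forall>f\<in>C. (f, e) \<in> R" using C(1) order_facts(3)[of e] eE by (auto simp: below_def)
    moreover have "C \<subseteq> insert e F" using C(1) by (auto simp: below_def)
    ultimately show ?thesis using C(2) by blast
  next
    case (Half a)
    then show ?thesis using S(2) e by (auto simp: balanced_def)
  next
    case Loose
    then have "balanced_circle \<Phi> {e}" using eE by (auto simp: balanced_circle_def)
    then show ?thesis using order_facts(3)[of e] eE by blast
  qed
  then show "e \<in> externally_active \<Phi> R (greedy_forest \<Phi> R S)"
    using externally_active_iff[OF F(1)] eE by (simp add: F_def)
qed

section \<open>Enlarging a forest by externally active edges\<close>

context
  fixes F A
  assumes F: "F \<in> spanning_forests \<Phi>" and A: "A \<subseteq> externally_active \<Phi> R F"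
begin

lemma forest_union_edges: "F \<union> A \<subseteq> edges \<Phi>" "F \<inter> A = {}"
  using spanning_forest_edges[OF F] A externally_active_iff[OF F] by blast+

lemma forest_union_potential: "potential \<Phi> F p \<Longrightarrow> potential \<Phi> (F \<union> A) p"
  using externally_active_potential[OF F] A unfolding potential_def by blast

lemma forest_union_balanced: "balanced \<Phi> (F \<union> A)"
proof -
  obtain p where "potential \<Phi> F p" using spanning_forest_card_potential[OF F] by blast
  then have p: "potential \<Phi> (F \<union> A) p" by (rule forest_union_potential)
  have "\<not> is_half (edge_of \<Phi> e)" if "e \<in> F \<union> A" for e
  proof (cases "e \<in> F")
    case True
    show ?thesis using spanning_forest_ordinary[OF F True] by (cases "edge_of \<Phi> e") auto
  next
    case False
    then show ?thesis using externally_active_not_half[OF F] A that by blast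
  qed
  then show ?thesis using potential_imp_balanced[OF forest_union_edges(1)] p by blast
qed

lemma forest_union_component: "component \<Phi> (F \<union> A) x = component \<Phi> F x"
proof (cases "x \<in> verts \<Phi>")
  case True
  have FE: "F \<subseteq> edges \<Phi>" by (rule spanning_forest_edges[OF F])
  have "component \<Phi> (F \<union> A) x \<subseteq> component \<Phi> F x"
  proof (rule component_subset_component[OF FE True])
    fix e a b g assume e: "e \<in> F \<union> A" "edge_of \<Phi> e = Ordinary a b g"
    show "b \<in> component \<Phi> F a"
    proof (cases "e \<in> F")
      case False
      then have "b \<in> component \<Phi> (below R F e) a"
        using externally_active_connected[OF F _ e(2)] A e(1) by blast
      then show ?thesis using component_mono[OF below_subset] by blast
    qed (use component_edge[OF FE] e in blast)
  qed
  then show ?thesis using component_mono[of F "F \<union> A" x] by blast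
next
  case False
  then show ?thesis
    using component_outside[OF forest_union_edges(1)] component_outside[OF spanning_forest_edges[OF F]]
    by simp
qed

lemma forest_union_components: "components \<Phi> (F \<union> A) = components \<Phi> F"
  by (simp add: components_def forest_union_component)

text \<open>Edges of \<open>A\<close> are rejected by \<open>externally_active_connected\<close>.
  For \<open>e\<close> in \<open>F\<close>, the smaller edges of \<open>F \<union> A\<close> connect
  no more than those of \<open>F\<close>, which lie in \<open>F - {e}\<close>, where the ends of
  \<open>e\<close> are apart.\<close>

lemma forest_union_greedy: "greedy_forest \<Phi> R (F \<union> A) = F"
proof -
  have red: "b \<in> component \<Phi> (below R F f) a"
    if "f \<in> A" "edge_of \<Phi> f = Ordinary a b g" for f a b g
    using externally_active_connected[OF F _ that(2)] A that(1) by blast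
  have redS: "b \<in> component \<Phi> (below R (F \<union> A) f) a"
    if "f \<in> A" "edge_of \<Phi> f = Ordinary a b g" for f a b g
    using red[OF that] component_mono[OF below_mono, of F "F \<union> A"] by blast
  have "e \<in> greedy_forest \<Phi> R (F \<union> A)" if e: "e \<in> F" for e
  proof -
    obtain a b g where eo: "edge_of \<Phi> e = Ordinary a b g"
      using is_ordinaryD[OF spanning_forest_ordinary[OF F e]] by blast
    have "a \<in> verts \<Phi>" using endpoints_verts[of e] spanning_forest_edges[OF F] e eo by auto
    then have "component \<Phi> (below R (F \<union> A) e) a \<subseteq> component \<Phi> (below R F e) a"
      using component_below_subset[OF _ forest_union_edges(1), of F] redS by blast
    also have "\<dots> \<subseteq> component \<Phi> (F - {e}) a" by (rule component_mono) (auto simp: below_def)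
    finally show ?thesis
      using spanning_forest_disconnected[OF F e eo] e eo unfolding greedy_forest_def by blast
  qed
  moreover have "e \<notin> greedy_forest \<Phi> R (F \<union> A)" if "e \<in> A" for e
    using redS[OF that] unfolding greedy_forest_def by blast
  ultimately show ?thesis using greedy_forest_subset[of "F \<union> A"] by blast
qed

text \<open>For a forest, edges and components together number the vertices, so exactly
  \<open>card A\<close> remains.\<close>

lemma forest_union_card:
  "card (F \<union> A) + card (components \<Phi> (F \<union> A)) - card (verts \<Phi>) = card A"
proof -
  have "finite F" "finite A" using forest_union_edges(1) finite_edge_set by auto
  then have "card (F \<union> A) = card F + card A"
    using forest_union_edges(2) by (rule card_Un_disjoint)
  then show ?thesis
    using conjunct1[OF spanning_forest_card_potential[OF F]] by (simp add: forest_union_components)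
qed

text \<open>One potential of \<open>F\<close> computes both gains, although the chosen paths may
  differ.\<close>

lemma forest_union_path_gain:
  assumes "y \<in> component \<Phi> F x"
  shows "path_gain \<Phi> (F \<union> A) x y = path_gain \<Phi> F x y"
proof -
  obtain p where p: "potential \<Phi> F p" using spanning_forest_card_potential[OF F] by blast
  show ?thesis
    using path_gain_potential[OF forest_union_edges(1) forest_union_potential[OF p]]
      path_gain_potential[OF spanning_forest_edges[OF F] p] assms
    by (simp add: forest_union_component)
qed

end

section \<open>Regrouping the sum by greedy forests\<close>

text \<open>Union and greedy splitting are mutually inverse: \<open>forest_union_greedy\<close>
  recovers the pair from the union, and \<open>greedy_forest_externally_active\<close> shows that
  each balanced set arises from an admissible pair.\<close>

lemma sum_balanced_eq_sum_forests:
  "(\<Sum>S | S \<subseteq> edges \<Phi> \<and> balanced \<Phi> S. t S)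
    = (\<Sum>F\<in>spanning_forests \<Phi>. \<Sum>A\<in>Pow (externally_active \<Phi> R F). t (F \<union> A))"
proof -
  have fin: "finite (spanning_forests \<Phi>)"
    by (rule finite_subset[of _ "Pow (edges \<Phi>)"])
       (use finite_edges in \<open>auto simp: spanning_forests_def\<close>)
  have "finite (externally_active \<Phi> R F)" if "F \<in> spanning_forests \<Phi>" for F
    using externally_active_iff[OF that] finite_edge_set by blast
  then have "(\<Sum>F\<in>spanning_forests \<Phi>. \<Sum>A\<in>Pow (externally_active \<Phi> R F). t (F \<union> A))
    = (\<Sum>(F, A)\<in>(SIGMA F:spanning_forests \<Phi>. Pow (externally_active \<Phi> R F)). t (F \<union> A))"
    using fin by (intro sum.Sigma) auto
  also have "\<dots> = (\<Sum>S | S \<subseteq> edges \<Phi> \<and> balanced \<Phi> S. t S)"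
  proof (rule sum.reindex_bij_witness[of _
        "\<lambda>S. (greedy_forest \<Phi> R S, S - greedy_forest \<Phi> R S)" "\<lambda>(F, A). F \<union> A"])
    fix FA assume FA: "FA \<in> (SIGMA F:spanning_forests \<Phi>. Pow (externally_active \<Phi> R F))"
    obtain F A where eq: "FA = (F, A)" by (cases FA)
    have F: "F \<in> spanning_forests \<Phi>" and A: "A \<subseteq> externally_active \<Phi> R F"
      using FA eq by auto
    show "(greedy_forest \<Phi> R (case FA of (F, A) \<Rightarrow> F \<union> A),
        (case FA of (F, A) \<Rightarrow> F \<union> A) - greedy_forest \<Phi> R (case FA of (F, A) \<Rightarrow> F \<union> A)) = FA"
      using forest_union_greedy[OF F A] forest_union_edges(2)[OF F A] by (auto simp: eq)
    show "(case FA of (F, A) \<Rightarrow> F \<union> A) \<in> {S. S \<subseteq> edges \<Phi> \<and> balanced \<Phi> S}"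
      using forest_union_balanced[OF F A] forest_union_edges(1)[OF F A] by (simp add: eq)
    show "t (case FA of (F, A) \<Rightarrow> F \<union> A) = (case FA of (F, A) \<Rightarrow> t (F \<union> A))"
      by (simp add: eq)
  next
    fix S assume "S \<in> {S. S \<subseteq> edges \<Phi> \<and> balanced \<Phi> S}"
    then have S: "S \<subseteq> edges \<Phi>" "balanced \<Phi> S" by auto
    show "(case (greedy_forest \<Phi> R S, S - greedy_forest \<Phi> R S) of (F, A) \<Rightarrow> F \<union> A) = S"
      using greedy_forest_subset by auto
    show "(greedy_forest \<Phi> R S, S - greedy_forest \<Phi> R S)
        \<in> (SIGMA F:spanning_forests \<Phi>. Pow (externally_active \<Phi> R F))"
      using greedy_forest_spanning[OF S(1)] greedy_forest_externally_active[OF S] by simp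
  qed
  finally show ?thesis by simp
qed

end

lemma forest_expansion_eq_total_dichromatic:
  fixes \<Phi> :: "('v, 'e, 'g::lattice_ordered_group) gain_graph"
    and act :: "'w::ab_semigroup_add \<Rightarrow> 'g \<Rightarrow> 'w"
    and u :: "'w \<Rightarrow> 'r::comm_ring_1"
  assumes "wf_gain_graph \<Phi>" "linear_order_on (edges \<Phi>) R"
  shows "forest_expansion \<Phi> act h R u y = total_dichromatic \<Phi> act h u (y - 1) 0"
proof -
  interpret ordered_gain_graph \<Phi> R by standard (fact assms)+
  \<comment> \<open>Written with all components, which for balanced \<open>S\<close> are the
    balanced ones.\<close>
  define t where "t S = (y - 1) ^ (card S + card (components \<Phi> S) - card (verts \<Phi>)) *
    (\<Prod>W\<in>components \<Phi> S. u (contracted_weight \<Phi> act h S W))" for S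
  have t: "t (F \<union> A) = (y - 1) ^ card A * (\<Prod>W\<in>components \<Phi> F. u (contracted_weight \<Phi> act h F W))"
    if F: "F \<in> spanning_forests \<Phi>" and A: "A \<subseteq> externally_active \<Phi> R F" for F A
  proof -
    \<comment> \<open>Equality of functions covers vertices outside the graph too: there both
      suprema are the same unspecified value of \<open>Sup_fin\<close> at the empty set.\<close>
    have "eta \<Phi> (F \<union> A) = eta \<Phi> F"
    proof
      fix x
      have "path_gain \<Phi> (F \<union> A) x ` component \<Phi> F x = path_gain \<Phi> F x ` component \<Phi> F x"
        by (rule image_cong) (simp_all add: forest_union_path_gain[OF F A])
      then show "eta \<Phi> (F \<union> A) x = eta \<Phi> F x"
        by (simp add: eta_def forest_union_component[OF F A])
    qed
    then show ?thesis
      unfolding t_def forest_union_card[OF F A]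
      by (simp add: forest_union_components[OF F A] contracted_weight_def)
  qed
  have "total_dichromatic \<Phi> act h u (y - 1) 0
      = (\<Sum>S\<in>Pow (edges \<Phi>). if balanced \<Phi> S then t S else 0)"
    unfolding total_dichromatic_def
  proof (rule sum.cong[OF refl])
    fix S assume "S \<in> Pow (edges \<Phi>)"
    then have S: "S \<subseteq> edges \<Phi>" by simp
    show "(y - 1) ^ (card S + card (balanced_components \<Phi> S) - card (verts \<Phi>)) *
        0 ^ (card (components \<Phi> S) - card (balanced_components \<Phi> S)) *
        (\<Prod>W\<in>balanced_components \<Phi> S. u (contracted_weight \<Phi> act h S W))
      = (if balanced \<Phi> S then t S else 0)"
      using card_balanced_components_iff[OF S] balanced_components_eq_components_iff[OF S]
      by (cases "balanced \<Phi> S") (simp_all add: t_def power_0_left)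
  qed
  also have "\<dots> = (\<Sum>S | S \<subseteq> edges \<Phi> \<and> balanced \<Phi> S. t S)"
    using finite_edges by (simp add: sum.If_cases Int_def)
  also have "\<dots> = (\<Sum>F\<in>spanning_forests \<Phi>. \<Sum>A\<in>Pow (externally_active \<Phi> R F). t (F \<union> A))"
    by (rule sum_balanced_eq_sum_forests)
  also have "\<dots> = forest_expansion \<Phi> act h R u y"
    unfolding forest_expansion_def
  proof (rule sum.cong[OF refl])
    fix F assume F: "F \<in> spanning_forests \<Phi>"
    have fin: "finite (externally_active \<Phi> R F)"
      using externally_active_iff[OF F] finite_edge_set by blast
    show "(\<Sum>A\<in>Pow (externally_active \<Phi> R F). t (F \<union> A)) = y ^ card (externally_active \<Phi> R F) *
        (\<Prod>W\<in>components \<Phi> F. u (contracted_weight \<Phi> act h F W))"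
      using sum_power_card_Pow[OF fin, of "y - 1"] by (simp add: t[OF F] flip: sum_distrib_right)
  qed
  finally show ?thesis by simp
qed

theorem theorem4p6:
  fixes \<Phi> :: "('v, 'e, 'g::lattice_ordered_group) gain_graph"
    and act :: "'w::ab_semigroup_add \<Rightarrow> 'g \<Rightarrow> 'w"
    and h :: "'v \<Rightarrow> 'w"
    and R :: "'e rel"
    and u :: "'w \<Rightarrow> 'r::comm_ring_1"
    and y :: 'r
  assumes "wf_gain_graph \<Phi>"
    and "right_action act"
    and "linear_order_on (edges \<Phi>) R"
  shows "(\<forall>R'. linear_order_on (edges \<Phi>) R' \<longrightarrow>
            forest_expansion \<Phi> act h R' u y = forest_expansion \<Phi> act h R u y) \<and>
         forest_expansion \<Phi> act h R u y = total_dichromatic \<Phi> act h u (y - 1) 0"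
  \<comment> \<open>The dichromatic side mentions no order, so using the identity for
    \<open>R\<close> and for \<open>R'\<close> gives independence.\<close>
  using forest_expansion_eq_total_dichromatic[OF assms(1)] assms(3) by metis

end
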